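(* Suppose that the copula process $\bm U=(U_t)_{t\in[0,1]}\in C[0,1]$ is in the $\delta$-neighborhood of a generalized Pareto copula process for some $\delta>0$, and let $\|\cdot\|_D$ be the $D$-norm of that generalized Pareto copula process and $m_D:=\|1_{[0,1]}\|_D$. Then the remainder term $r$ in the expansion $$P\bigl(\bm U\le(1-c)1_{[0,1]}\bigr)=1-c\bigl(m_D+r(-c)\bigr),\qquad c>0,$$ satisfies $r(s)=O(|s|^\delta)$ as $s\uparrow0$. Moreover, let $\bm U^{(1)},\bm U^{(2)},\dots$ be independent copies of $\bm U$, let $k\in\mathbb{N}$, $k\ge2$, be fixed, and let $c_n>0$ satisfy $c_n\to0$, $nc_n\to\infty$ and $nc_n^{1+2\delta}\to0$ as $n\to\infty$. Then $$T_n(c_n)\to_D\sum_{i=1}^{k-1}\lambda_i\xi_i^2\quad\text{as }n\to\infty,$$ where $\xi_1,\dots,\xi_{k-1}$ are independent standard normal random variables and $\lambda_i=\frac1{4\sin^2\left(\frac ik\frac\pi2\right)}$, $1\le i\le k-1$.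
   Context: $\to_D$ denotes convergence in distribution; operations and inequalities between functions are pointwise on $[0,1]$; $1_{[0,1]}$ is the constant function $1$ on $[0,1]$. $E[0,1]$ is the set of bounded functions $f:[0,1]\to\mathbb{R}$ with only finitely many discontinuities, $E^-[0,1]$ the subset of those attaining only non-positive values, and $\|f\|_\infty=\sup_{t\in[0,1]}|f(t)|$. A generator process is a stochastic process $\bm Z=(Z_t)_{t\in[0,1]}$ with sample paths in $C[0,1]$ such that $0\le Z_t\le q$ for all $t\in[0,1]$, for some $q\in\mathbb{R}$, and $E(Z_t)=1$ for all $t\in[0,1]$. The associated $D$-norm is $\|f\|_D:=E\left(\sup_{t\in[0,1]}(|f(t)|Z_t)\right)$, $f\in E[0,1]$; in particular $\|1_{[0,1]}\|_D=E(\sup_{t\in[0,1]}Z_t)$. A copula process is a stochastic process $\bm U=(U_t)_{t\in[0,1]}$ with each $U_t$ uniformly distributed on $(0,1)$. A copula process $\bm V\in C[0,1]$ (i.e. with sample paths in $C[0,1]$) is a generalized Pareto copula process (GPCP) with $D$-norm $\|\cdot\|_D$ if there exists $\varepsilon_0>0$ such that $P(\bm V\le1_{[0,1]}+f)=1-\|f\|_D$ for all $f\in E^-[0,1]$ with $\|f\|_\infty\le\varepsilon_0$. A copula process $\bm U\in C[0,1]$ is in the $\delta$-neighborhood of a GPCP if there is a GPCP $\bm V$ such that for every $f\in E^-[0,1]$ $$P(\bm U\le1_{[0,1]}+cf)=P(\bm V\le1_{[0,1]}+cf)+O(c^{1+\delta})\quad\text{as }c\downarrow0 .$$ For $s<0$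 put $S_{\bm U}(s):=\int_0^11_{(s,\infty)}(U_t-1)\,dt$. For $c>0$ and $1\le j\le k$ put $n_j(c):=\sum_{i=1}^n1_{(0,1]}\left(S_{\bm U^{(i)}}\left(-\frac cj\right)\right)$. The test statistic is $$T_n(c):=\frac{\sum_{j=1}^k\left(j\,n_j(c)-\frac1k\sum_{\ell=1}^k\ell\,n_\ell(c)\right)^2}{\frac1k\sum_{\ell=1}^k\ell\,n_\ell(c)} .$$ *)

theory Defs
  imports "HOL-Probability.Probability" "HOL-Library.Landau_Symbols"
begin

text \<open>A process on \<open>[0,1]\<close> is a function \<open>U\<close> of type \<open>real \<Rightarrow> 'a \<Rightarrow> real\<close>, time argument first.
  Functions on \<open>[0,1]\<close> are functions on all reals of which only the values on \<open>{0..1}\<close> are used.\<close>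

definition stochastic_process :: "'a measure \<Rightarrow> (real \<Rightarrow> 'a \<Rightarrow> real) \<Rightarrow> bool" where
  "stochastic_process M U \<longleftrightarrow> prob_space M \<and> (\<forall>t\<in>{0..1}. U t \<in> borel_measurable M)"

definition paths_in_C :: "'a measure \<Rightarrow> (real \<Rightarrow> 'a \<Rightarrow> real) \<Rightarrow> bool" where
  "paths_in_C M U \<longleftrightarrow> (\<forall>\<omega>\<in>space M. continuous_on {0..1} (\<lambda>t. U t \<omega>))"

definition E01 :: "(real \<Rightarrow> real) set" where
  "E01 = {f. bounded (f ` {0..1}) \<and> finite {t\<in>{0..1}. \<not> continuous (at t within {0..1}) f}}"

definition E01_neg :: "(real \<Rightarrow> real) set" where
  "E01_neg = {f \<in> E01. \<forall>t\<in>{0..1}. f t \<le> 0}"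

definition sup_norm :: "(real \<Rightarrow> real) \<Rightarrow> real" where
  "sup_norm f = (SUP t\<in>{0..1}. \<bar>f t\<bar>)"

definition generator_process :: "'a measure \<Rightarrow> (real \<Rightarrow> 'a \<Rightarrow> real) \<Rightarrow> bool" where
  "generator_process M Z \<longleftrightarrow>
     stochastic_process M Z \<and> paths_in_C M Z \<and>
     (\<exists>q. \<forall>\<omega>\<in>space M. \<forall>t\<in>{0..1}. 0 \<le> Z t \<omega> \<and> Z t \<omega> \<le> q) \<and>
     (\<forall>t\<in>{0..1}. (\<integral>\<omega>. Z t \<omega> \<partial>M) = 1)"

definition D_norm :: "'a measure \<Rightarrow> (real \<Rightarrow> 'a \<Rightarrow> real) \<Rightarrow> (real \<Rightarrow> real) \<Rightarrow> real" where
  "D_norm M Z f = (\<integral>\<omega>. (SUP t\<in>{0..1}. \<bar>f t\<bar> * Z t \<omega>) \<partial>M)"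

definition copula_process :: "'a measure \<Rightarrow> (real \<Rightarrow> 'a \<Rightarrow> real) \<Rightarrow> bool" where
  "copula_process M U \<longleftrightarrow>
     stochastic_process M U \<and>
     (\<forall>t\<in>{0..1}. distr M borel (U t) = uniform_measure lborel {0<..<1})"

definition prob_le :: "'a measure \<Rightarrow> (real \<Rightarrow> 'a \<Rightarrow> real) \<Rightarrow> (real \<Rightarrow> real) \<Rightarrow> real" where
  "prob_le M U g = measure M {\<omega>\<in>space M. \<forall>t\<in>{0..1}. U t \<omega> \<le> g t}"

text \<open>The process \<open>V\<close> on \<open>N\<close> is a GPCP whose \<open>D\<close>-norm is the one generated by the process
  \<open>Z\<close> on \<open>Q\<close>; the two processes need not be defined on the same probability space.\<close>

definition GPCP :: "'b measure \<Rightarrow> (real \<Rightarrow> 'b \<Rightarrow> real) \<Rightarrow> 'c measure \<Rightarrow> (real \<Rightarrow> 'c \<Rightarrow> real) \<Rightarrow> bool" where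
  "GPCP N V Q Z \<longleftrightarrow>
     generator_process Q Z \<and> copula_process N V \<and> paths_in_C N V \<and>
     (\<exists>\<epsilon>>0. \<forall>f\<in>E01_neg. sup_norm f \<le> \<epsilon> \<longrightarrow> prob_le N V (\<lambda>t. 1 + f t) = 1 - D_norm Q Z f)"

text \<open>The existential quantifier over the GPCP \<open>V\<close> is rendered by keeping \<open>V\<close> (with its
  space and generator) as a parameter: existential quantification over the type of the underlying
  sample space is not available, and as a hypothesis the two forms agree.\<close>

definition in_delta_neighborhood ::
  "real \<Rightarrow> 'a measure \<Rightarrow> (real \<Rightarrow> 'a \<Rightarrow> real) \<Rightarrow> 'b measure \<Rightarrow> (real \<Rightarrow> 'b \<Rightarrow> real) \<Rightarrow>
    'c measure \<Rightarrow> (real \<Rightarrow> 'c \<Rightarrow> real) \<Rightarrow> bool" where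
  "in_delta_neighborhood \<delta> M U N V Q Z \<longleftrightarrow>
     copula_process M U \<and> paths_in_C M U \<and> GPCP N V Q Z \<and>
     (\<forall>f\<in>E01_neg.
        (\<lambda>c. prob_le M U (\<lambda>t. 1 + c * f t) - prob_le N V (\<lambda>t. 1 + c * f t))
          \<in> O[at_right 0](\<lambda>c. c powr (1 + \<delta>)))"

text \<open>On \<open>C[0,1]\<close> the product \<open>\<sigma>\<close>-algebra of the coordinates induces the Borel \<open>\<sigma>\<close>-algebra of
  the supremum norm.\<close>

abbreviation path_algebra :: "(real \<Rightarrow> real) measure" where
  "path_algebra \<equiv> PiM {0..1} (\<lambda>_. borel)"

definition sample_path :: "(real \<Rightarrow> 'a \<Rightarrow> real) \<Rightarrow> 'a \<Rightarrow> real \<Rightarrow> real" where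
  "sample_path U \<omega> = (\<lambda>t\<in>{0..1}. U t \<omega>)"

definition independent_copies ::
  "'a measure \<Rightarrow> (real \<Rightarrow> 'a \<Rightarrow> real) \<Rightarrow> 'd measure \<Rightarrow> (nat \<Rightarrow> real \<Rightarrow> 'd \<Rightarrow> real) \<Rightarrow> bool" where
  "independent_copies M U P X \<longleftrightarrow>
     prob_space P \<and>
     (\<forall>i\<ge>1. paths_in_C P (X i)) \<and>
     (\<forall>i\<ge>1. distr P path_algebra (sample_path (X i)) = distr M path_algebra (sample_path U)) \<and>
     prob_space.indep_vars P (\<lambda>_. path_algebra) (\<lambda>i. sample_path (X i)) {1..}"

definition sojourn :: "(real \<Rightarrow> real) \<Rightarrow> real \<Rightarrow> real" where
  "sojourn u s = (LBINT t:{0..1}. indicat_real {s<..} (u t - 1))"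

text \<open>Here \<open>u i\<close> is the path of the \<open>i\<close>-th copy, \<open>i \<ge> 1\<close>.\<close>

definition exceedance_count :: "(nat \<Rightarrow> real \<Rightarrow> real) \<Rightarrow> nat \<Rightarrow> real \<Rightarrow> nat \<Rightarrow> real" where
  "exceedance_count u n c j = (\<Sum>i=1..n. indicat_real {0<..1} (sojourn (u i) (- c / real j)))"

text \<open>If there are no exceedances at all, the quotient is \<open>0 / 0\<close> and takes the value \<open>0\<close>.\<close>

definition test_statistic :: "nat \<Rightarrow> (nat \<Rightarrow> real \<Rightarrow> real) \<Rightarrow> nat \<Rightarrow> real \<Rightarrow> real" where
  "test_statistic k u n c =
     (\<Sum>j=1..k. (real j * exceedance_count u n c j
                  - 1 / real k * (\<Sum>l=1..k. real l * exceedance_count u n c l))\<^sup>2)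
     / (1 / real k * (\<Sum>l=1..k. real l * exceedance_count u n c l))"

end

theory Submission
  imports Defs
begin

text \<open>
  A path has positive sojourn time above \<open>1 - c/j\<close> iff it exceeds that level somewhere, so
  \<open>n\<^sub>j(c)\<close> counts the occurrences of an event of probability \<open>(c/j) (m\<^sub>D + O(c\<^sup>\<delta>))\<close>, and these events
  decrease in \<open>j\<close>. Hence the vector \<open>(j n\<^sub>j(c) / sqrt (n c m\<^sub>D))\<^sub>j\<close>, once centered, has asymptotic
  covariance \<open>min j l\<close>, and the numerator of \<open>T\<^sub>n\<close> is asymptotically \<open>n c m\<^sub>D\<close> times the squared norm of a
  centered Brownian path at the times \<open>1, \<dots>, k\<close>; the discrete cosine transform diagonalizes it with
  eigenvalues \<open>\<lambda>\<^sub>i\<close>.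

  Only one-dimensional characteristic functions are needed: averaging \<open>exp (\<i> \<langle>W, G\<rangle>)\<close> over an independent
  standard normal vector \<open>G\<close> gives \<open>exp (- \<parallel>W\<parallel>\<^sup>2 / 2)\<close>, so convergence of the characteristic functions of
  all linear forms in \<open>W\<close> gives convergence of the Laplace transform of \<open>\<parallel>W\<parallel>\<^sup>2\<close>, and for nonnegative
  variables this implies weak convergence, by polynomial approximation in \<open>exp (- x)\<close>.
\<close>

section \<open>Weak convergence of sums of squares\<close>

text \<open>By Stone-Weierstrass, \<open>f\<close> is uniformly close on [0,1] to a polynomial. The
  integral of a polynomial in \<open>exp (- x)\<close> is a finite combination of Laplace transforms
  at natural numbers, and these converge by assumption.\<close>

lemma tendsto_integral_exp_composition:
  fixes \<mu> :: "nat \<Rightarrow> real measure" and f :: "real \<Rightarrow> real"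
  assumes \<mu>: "\<And>n. real_distribution (\<mu> n)" and \<nu>: "real_distribution \<nu>"
    and pos\<mu>: "\<And>n. AE x in \<mu> n. 0 \<le> x" and pos\<nu>: "AE x in \<nu>. 0 \<le> x"
    and lim: "\<And>k::nat. (\<lambda>n. \<integral>x. exp (- (real k * x)) \<partial>\<mu> n) \<longlonglongrightarrow> (\<integral>x. exp (- (real k * x)) \<partial>\<nu>)"
    and f: "continuous_on UNIV f"
  shows "(\<lambda>n. \<integral>x. f (exp (- x)) \<partial>\<mu> n) \<longlonglongrightarrow> (\<integral>x. f (exp (- x)) \<partial>\<nu>)"
proof (rule LIMSEQ_I)
  fix e :: real assume "0 < e"
  have "continuous_on {0..1} f" using f continuous_on_subset by blast
  then obtain g where g: "real_polynomial_function g"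
    and fg: "\<And>x. x \<in> {0..1} \<Longrightarrow> \<bar>f x - g x\<bar> < e/4"
    using Stone_Weierstrass_real_polynomial_function[of "{0..1::real}" f "e/4"] \<open>0 < e\<close> by auto
  obtain a d where gd: "g = (\<lambda>x. \<Sum>i\<le>d. a i * x^i)"
    using g real_polynomial_function_iff_sum by blast
  have [measurable]: "f \<in> borel_measurable borel"
    using f borel_measurable_continuous_onI by blast
  have [measurable]: "g \<in> borel_measurable borel"
    unfolding gd by measurable
  have "compact (f ` {0..1})"
    using \<open>continuous_on {0..1} f\<close> by (intro compact_continuous_image) auto
  then obtain B where B: "\<And>x. x \<in> {0..1} \<Longrightarrow> \<bar>f x\<bar> \<le> B"
    using compact_imp_bounded bounded_iff by (metis imageI real_norm_def)
  \<comment> \<open>The error does not depend on the distribution, because \<open>exp (- x)\<close>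
    lies in [0,1] almost surely. It therefore serves every \<open>\<mu> n\<close> and
    \<open>\<nu>\<close>; a third \<open>e/4\<close> for the polynomial integrals keeps the total
    below \<open>e\<close>.\<close>
  have close: "\<bar>(\<integral>x. f (exp (- x)) \<partial>\<rho>) - (\<Sum>i\<le>d. a i * (\<integral>x. exp (- (real i * x)) \<partial>\<rho>))\<bar> \<le> e/4"
    if \<rho>: "real_distribution \<rho>" "AE x in \<rho>. 0 \<le> x" for \<rho>
  proof -
    interpret real_distribution \<rho> by fact
    have int_exp: "integrable \<rho> (\<lambda>x. exp (- (real i * x)))" for i
      by (rule integrable_const_bound[where B=1]) (use \<rho>(2) in auto)
    have int_f: "integrable \<rho> (\<lambda>x. f (exp (- x)))"
      by (rule integrable_const_bound[where B=B]) (use \<rho>(2) B in auto)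
    have geq: "g (exp (- x)) = (\<Sum>i\<le>d. a i * exp (- (real i * x)))" for x
      unfolding gd by (simp add: exp_of_nat_mult[symmetric])
    have int_g: "integrable \<rho> (\<lambda>x. g (exp (- x)))"
      unfolding geq using int_exp by auto
    have "(\<Sum>i\<le>d. a i * (\<integral>x. exp (- (real i * x)) \<partial>\<rho>)) = (\<integral>x. g (exp (- x)) \<partial>\<rho>)"
      unfolding geq using int_exp by simp
    then have "\<bar>(\<integral>x. f (exp (- x)) \<partial>\<rho>) - (\<Sum>i\<le>d. a i * (\<integral>x. exp (- (real i * x)) \<partial>\<rho>))\<bar>
       = \<bar>\<integral>x. f (exp (- x)) - g (exp (- x)) \<partial>\<rho>\<bar>"
      using int_f int_g by simp
    also have "\<dots> \<le> (\<integral>x. \<bar>f (exp (- x)) - g (exp (- x))\<bar> \<partial>\<rho>)"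
      by (rule integral_abs_bound)
    also have "\<dots> \<le> (\<integral>x. e/4 \<partial>\<rho>)"
    proof (rule integral_mono_AE)
      show "AE x in \<rho>. \<bar>f (exp (- x)) - g (exp (- x))\<bar> \<le> e/4"
        using \<rho>(2) by eventually_elim (rule less_imp_le[OF fg], auto)
    qed (use int_f int_g in auto)
    also have "\<dots> = e/4" using prob_space by simp
    finally show ?thesis .
  qed
  have "(\<lambda>n. \<Sum>i\<le>d. a i * (\<integral>x. exp (- (real i * x)) \<partial>\<mu> n))
      \<longlonglongrightarrow> (\<Sum>i\<le>d. a i * (\<integral>x. exp (- (real i * x)) \<partial>\<nu>))"
    by (intro tendsto_intros lim)
  from LIMSEQ_D[OF this, of "e/4"] \<open>0 < e\<close> obtain n0 where n0: "\<And>n. n \<ge> n0 \<Longrightarrow>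
     \<bar>(\<Sum>i\<le>d. a i * (\<integral>x. exp (- (real i * x)) \<partial>\<mu> n)) - (\<Sum>i\<le>d. a i * (\<integral>x. exp (- (real i * x)) \<partial>\<nu>))\<bar> < e/4"
    by auto
  show "\<exists>no. \<forall>n\<ge>no. norm ((\<integral>x. f (exp (- x)) \<partial>\<mu> n) - (\<integral>x. f (exp (- x)) \<partial>\<nu>)) < e"
  proof (intro exI allI impI)
    fix n assume "n \<ge> n0"
    from n0[OF this] close[OF \<mu> pos\<mu>, of n] close[OF \<nu> pos\<nu>] \<open>0 < e\<close>
    show "norm ((\<integral>x. f (exp (- x)) \<partial>\<mu> n) - (\<integral>x. f (exp (- x)) \<partial>\<nu>)) < e"
      unfolding real_norm_def by linarith
  qed
qed

text \<open>The continuous step functions determine weak convergence, and each of them is a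
  continuous function of \<open>exp (- x)\<close>.\<close>

lemma weak_conv_m_of_laplace:
  fixes \<mu> :: "nat \<Rightarrow> real measure"
  assumes \<mu>: "\<And>n. real_distribution (\<mu> n)" and \<nu>: "real_distribution \<nu>"
    and "\<And>n. AE x in \<mu> n. 0 \<le> x" and "AE x in \<nu>. 0 \<le> x"
    and "\<And>k::nat. (\<lambda>n. \<integral>x. exp (- (real k * x)) \<partial>\<mu> n) \<longlonglongrightarrow> (\<integral>x. exp (- (real k * x)) \<partial>\<nu>)"
  shows "weak_conv_m \<mu> \<nu>"
proof (rule integral_cts_step_conv_imp_weak_conv[OF \<mu> \<nu>])
  fix x y :: real assume "x < y"
  \<comment> \<open>\<open>cts_step x y\<close> vanishes from \<open>y\<close> on, so the truncation at \<open>exp (- y)\<close> only serves continuity at \<open>0\<close>.\<close>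
  define f where "f z = cts_step x y (- ln (max z (exp (- y))))" for z
  have f: "f (exp (- q)) = cts_step x y q" for q
    unfolding f_def using \<open>x < y\<close> by (auto simp: max_def cts_step_def)
  have "continuous_on UNIV f"
    unfolding f_def
    by (rule continuous_on_compose2[OF uniformly_continuous_imp_continuous[OF
          cts_step_uniformly_continuous[OF \<open>x < y\<close>]]])
      (auto intro!: continuous_intros dest: arg_cong[where f="\<lambda>z. z > 0"] simp: less_max_iff_disj)
  from tendsto_integral_exp_composition[OF assms this]
  show "(\<lambda>n. integral\<^sup>L (\<mu> n) (cts_step x y)) \<longlonglongrightarrow> integral\<^sup>L \<nu> (cts_step x y)"
    unfolding f by simp
qed

section \<open>Gaussian linearization of Laplace transforms of sums of squares\<close>

lemma expectation_iexp_std_normal: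
  assumes "prob_space R" "distributed R lborel \<xi> std_normal_density"
  shows "(\<integral>x. iexp (w * \<xi> x) \<partial>R) = of_real (exp (- (w\<^sup>2) / 2))"
proof -
  interpret prob_space R by fact
  have [measurable]: "\<xi> \<in> borel_measurable R"
    using distributed_measurable[OF assms(2)] by simp
  have d: "distr R borel \<xi> = std_normal_distribution"
    using distributed_distr_eq_density[OF assms(2)]
    by (metis (no_types, lifting) distr_cong sets_lborel)
  have "(\<integral>x. iexp (w * \<xi> x) \<partial>R) = char (distr R borel \<xi>) w"
    unfolding char_def by (subst integral_distr) auto
  then show ?thesis by (simp add: d char_std_normal_distribution)
qed

lemma iexp_sum: "finite I \<Longrightarrow> iexp (\<Sum>i\<in>I. f i) = (\<Prod>i\<in>I. iexp (f i))"
  by (simp add: exp_sum sum_distrib_left)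

lemma expectation_iexp_sum_std_normal:
  assumes R: "prob_space R" and "finite I" and ind: "prob_space.indep_vars R (\<lambda>_. borel) \<xi> I"
    and dist: "\<And>i. i \<in> I \<Longrightarrow> distributed R lborel (\<xi> i) std_normal_density"
  shows "(\<integral>x. iexp (\<Sum>i\<in>I. w i * \<xi> i x) \<partial>R) = of_real (exp (- (\<Sum>i\<in>I. (w i)\<^sup>2) / 2))"
proof -
  interpret prob_space R by fact
  have rv: "\<xi> i \<in> borel_measurable R" if "i \<in> I" for i
    using ind that unfolding indep_vars_def2 by auto
  have "(\<integral>x. iexp (\<Sum>i\<in>I. w i * \<xi> i x) \<partial>R) = (\<integral>x. (\<Prod>i\<in>I. iexp (w i * \<xi> i x)) \<partial>R)"
    by (simp only: iexp_sum[OF \<open>finite I\<close>])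
  also have "\<dots> = (\<Prod>i\<in>I. \<integral>x. iexp (w i * \<xi> i x) \<partial>R)"
  proof (rule indep_vars_lebesgue_integral[OF \<open>finite I\<close>])
    show "indep_vars (\<lambda>_. borel) (\<lambda>i x. iexp (w i * \<xi> i x)) I"
      by (rule indep_vars_compose2[OF ind]) measurable
    show "integrable R (\<lambda>x. iexp (w i * \<xi> i x))" if "i \<in> I" for i
      using rv[OF that] by (intro integrable_iexp) auto
  qed
  also have "\<dots> = (\<Prod>i\<in>I. of_real (exp (- ((w i)\<^sup>2) / 2)))"
    using expectation_iexp_std_normal[OF R dist] by (intro prod.cong) auto
  also have "\<dots> = of_real (exp (- (\<Sum>i\<in>I. (w i)\<^sup>2) / 2))"
    by (simp only: of_real_prod[symmetric] exp_sum[OF \<open>finite I\<close>, symmetric]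
        sum_negf sum_divide_distrib[symmetric])
  finally show ?thesis .
qed

text \<open>The auxiliary Gaussian vector lives on its own space \<open>R\<close>, so its
  independence from \<open>W\<close> is that of the product measure. Fubini applies since the
  integrand has modulus 1.\<close>

lemma expectation_exp_sum_squares_linearize:
  assumes P: "prob_space P" and R: "prob_space R" and "finite I"
    and ind: "prob_space.indep_vars R (\<lambda>_. borel) \<xi> I"
    and dist: "\<And>i. i \<in> I \<Longrightarrow> distributed R lborel (\<xi> i) std_normal_density"
    and W: "\<And>i. i \<in> I \<Longrightarrow> W i \<in> borel_measurable P"
  shows "complex_of_real (\<integral>\<omega>. exp (- (\<Sum>i\<in>I. (W i \<omega>)\<^sup>2) / 2) \<partial>P)
      = (\<integral>x. (\<integral>\<omega>. iexp (\<Sum>i\<in>I. W i \<omega> * \<xi> i x) \<partial>P) \<partial>R)"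
proof -
  interpret P: prob_space P by fact
  interpret R: prob_space R by fact
  interpret PR: pair_prob_space P R ..
  have rv[measurable]: "\<xi> i \<in> borel_measurable R" if "i \<in> I" for i
    using ind that unfolding R.indep_vars_def2 by auto
  note W[measurable]
  have "complex_of_real (\<integral>\<omega>. exp (- (\<Sum>i\<in>I. (W i \<omega>)\<^sup>2) / 2) \<partial>P)
     = (\<integral>\<omega>. of_real (exp (- (\<Sum>i\<in>I. (W i \<omega>)\<^sup>2) / 2)) \<partial>P)"
    by (rule integral_complex_of_real[symmetric])
  also have "\<dots> = (\<integral>\<omega>. (\<integral>x. iexp (\<Sum>i\<in>I. W i \<omega> * \<xi> i x) \<partial>R) \<partial>P)"
    by (simp only: expectation_iexp_sum_std_normal[OF R \<open>finite I\<close> ind dist])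
  also have "\<dots> = (\<integral>x. (\<integral>\<omega>. iexp (\<Sum>i\<in>I. W i \<omega> * \<xi> i x) \<partial>P) \<partial>R)"
  proof (rule PR.Fubini_integral[symmetric])
    have "(\<lambda>z. \<Sum>i\<in>I. W i (fst z) * \<xi> i (snd z)) \<in> borel_measurable (P \<Otimes>\<^sub>M R)"
      by measurable
    then have "integrable (P \<Otimes>\<^sub>M R) (\<lambda>z. iexp (\<Sum>i\<in>I. W i (fst z) * \<xi> i (snd z)))"
      by (intro PR.integrable_iexp borel_measurable_of_real) simp_all
    then show "integrable (P \<Otimes>\<^sub>M R) (\<lambda>(\<omega>, x). iexp (\<Sum>i\<in>I. W i \<omega> * \<xi> i x))"
      by (simp only: case_prod_unfold)
  qed
  finally show ?thesis .
qed

text \<open>For fixed \<open>x\<close> the hypothesis \<open>lim\<close> is used with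
  \<open>u i = t * \<xi> i x\<close>; characteristic functions are bounded by 1, so dominated
  convergence in \<open>x\<close> applies. The same \<open>\<xi>\<close> is both the auxiliary
  Gaussian vector and the source of the limit variable, so the limit needs no second
  linearization.\<close>

lemma tendsto_laplace_sum_squares:
  assumes P: "prob_space P" and R: "prob_space R" and "finite I"
    and ind: "prob_space.indep_vars R (\<lambda>_. borel) \<xi> I"
    and dist: "\<And>i. i \<in> I \<Longrightarrow> distributed R lborel (\<xi> i) std_normal_density"
    and W: "\<And>n i. i \<in> I \<Longrightarrow> W n i \<in> borel_measurable P"
    and lim: "\<And>u. (\<lambda>n. \<integral>\<omega>. iexp (\<Sum>i\<in>I. u i * W n i \<omega>) \<partial>P)
        \<longlonglongrightarrow> of_real (exp (- (\<Sum>i\<in>I. l i * (u i)\<^sup>2) / 2))"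
    and "s \<ge> 0"
  shows "(\<lambda>n. \<integral>\<omega>. exp (- (s * (\<Sum>i\<in>I. (W n i \<omega>)\<^sup>2))) \<partial>P)
      \<longlonglongrightarrow> (\<integral>x. exp (- (s * (\<Sum>i\<in>I. l i * (\<xi> i x)\<^sup>2))) \<partial>R)"
proof -
  interpret P: prob_space P by fact
  interpret R: prob_space R by fact
  interpret PR: pair_prob_space P R ..
  note W[measurable]
  have rv[measurable]: "\<xi> i \<in> borel_measurable R" if "i \<in> I" for i
    using ind that unfolding R.indep_vars_def2 by auto
  \<comment> \<open>This scaling turns \<open>exp (- (t * y)\<^sup>2 / 2)\<close> into
    \<open>exp (- s * y\<^sup>2)\<close>.\<close>
  define t where "t = sqrt (2 * s)"
  have t: "t\<^sup>2 = 2 * s" using \<open>s \<ge> 0\<close> by (simp add: t_def)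
  have e1: "complex_of_real (\<integral>\<omega>. exp (- (s * (\<Sum>i\<in>I. (W n i \<omega>)\<^sup>2))) \<partial>P)
      = (\<integral>x. (\<integral>\<omega>. iexp (\<Sum>i\<in>I. (t * \<xi> i x) * W n i \<omega>) \<partial>P) \<partial>R)" for n
  proof -
    have "complex_of_real (\<integral>\<omega>. exp (- (s * (\<Sum>i\<in>I. (W n i \<omega>)\<^sup>2))) \<partial>P)
       = complex_of_real (\<integral>\<omega>. exp (- (\<Sum>i\<in>I. (t * W n i \<omega>)\<^sup>2) / 2) \<partial>P)"
      by (simp add: power_mult_distrib t sum_distrib_left[symmetric])
    also have "\<dots> = (\<integral>x. (\<integral>\<omega>. iexp (\<Sum>i\<in>I. (t * W n i \<omega>) * \<xi> i x) \<partial>P) \<partial>R)"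
      by (rule expectation_exp_sum_squares_linearize[OF P R \<open>finite I\<close> ind dist]) auto
    also have "\<dots> = (\<integral>x. (\<integral>\<omega>. iexp (\<Sum>i\<in>I. (t * \<xi> i x) * W n i \<omega>) \<partial>P) \<partial>R)"
      by (simp only: mult.assoc mult.left_commute mult.commute)
    finally show ?thesis .
  qed
  have "(\<lambda>n. \<integral>x. (\<integral>\<omega>. iexp (\<Sum>i\<in>I. (t * \<xi> i x) * W n i \<omega>) \<partial>P) \<partial>R)
     \<longlonglongrightarrow> (\<integral>x. of_real (exp (- (\<Sum>i\<in>I. l i * (t * \<xi> i x)\<^sup>2) / 2)) \<partial>R)"
  proof (rule integral_dominated_convergence[where w="\<lambda>_. 1"])
    show "AE x in R. (\<lambda>n. \<integral>\<omega>. iexp (\<Sum>i\<in>I. (t * \<xi> i x) * W n i \<omega>) \<partial>P)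
       \<longlonglongrightarrow> of_real (exp (- (\<Sum>i\<in>I. l i * (t * \<xi> i x)\<^sup>2) / 2))"
      by (intro AE_I2 lim)
    show "AE x in R. norm (\<integral>\<omega>. iexp (\<Sum>i\<in>I. (t * \<xi> i x) * W n i \<omega>) \<partial>P) \<le> 1" for n
    proof (rule AE_I2)
      fix x
      have "norm (\<integral>\<omega>. iexp (\<Sum>i\<in>I. (t * \<xi> i x) * W n i \<omega>) \<partial>P)
         \<le> (\<integral>\<omega>. norm (iexp (\<Sum>i\<in>I. (t * \<xi> i x) * W n i \<omega>)) \<partial>P)"
        by (rule integral_norm_bound)
      also have "\<dots> = 1" using P.prob_space by (simp only: norm_exp_i_times) simp
      finally show "norm (\<integral>\<omega>. iexp (\<Sum>i\<in>I. (t * \<xi> i x) * W n i \<omega>) \<partial>P) \<le> 1" .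
    qed
    show "(\<lambda>x. \<integral>\<omega>. iexp (\<Sum>i\<in>I. (t * \<xi> i x) * W n i \<omega>) \<partial>P) \<in> borel_measurable R" for n
      by (rule P.borel_measurable_lebesgue_integral) measurable
    show "(\<lambda>x. complex_of_real (exp (- (\<Sum>i\<in>I. l i * (t * \<xi> i x)\<^sup>2) / 2))) \<in> borel_measurable R"
      by measurable
  qed simp
  also have "(\<integral>x. complex_of_real (exp (- (\<Sum>i\<in>I. l i * (t * \<xi> i x)\<^sup>2) / 2)) \<partial>R)
     = of_real (\<integral>x. exp (- (s * (\<Sum>i\<in>I. l i * (\<xi> i x)\<^sup>2))) \<partial>R)"
  proof -
    have "- (\<Sum>i\<in>I. l i * (t * \<xi> i x)\<^sup>2) / 2 = - (s * (\<Sum>i\<in>I. l i * (\<xi> i x)\<^sup>2))" for x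
      by (simp add: power_mult_distrib t sum_distrib_left algebra_simps sum_divide_distrib)
    then show ?thesis by (simp only: integral_complex_of_real)
  qed
  finally show ?thesis
    unfolding e1[symmetric] by (simp only: tendsto_of_real_iff)
qed

section \<open>Limits of characteristic functions of row sums, and random denominators\<close>

text \<open>Compare with the powers of \<open>w n = 1 + a / n\<close>: on the closed unit disc the
  n-th powers of two numbers differ by at most n times their distance, and n times the distance is
  the assumed vanishing quantity.\<close>

lemma tendsto_power_complex_exp:
  fixes z :: "nat \<Rightarrow> complex"
  assumes "(\<lambda>n. of_nat n * (z n - 1)) \<longlonglongrightarrow> of_real a" and "a \<le> 0" and "\<And>n. norm (z n) \<le> 1"
  shows "(\<lambda>n. z n ^ n) \<longlonglongrightarrow> of_real (exp a)"
proof -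
  define w :: "nat \<Rightarrow> complex" where "w n = of_real (1 + a / real n)" for n
  have "(\<lambda>n. complex_of_real ((1 + a / real n) ^ n)) \<longlonglongrightarrow> of_real (exp a)"
    by (intro tendsto_of_real tendsto_exp_limit_sequentially)
  then have w: "(\<lambda>n. w n ^ n) \<longlonglongrightarrow> of_real (exp a)"
    by (simp add: w_def)
  have "(\<lambda>n. z n ^ n - w n ^ n) \<longlonglongrightarrow> 0"
  proof (rule Lim_null_comparison)
    have "(\<lambda>n. norm (of_nat n * (z n - 1) - of_real a)) \<longlonglongrightarrow> 0"
      using tendsto_norm_zero[OF LIM_zero[OF assms(1)]] .
    then show "(\<lambda>n. norm (of_nat n * (z n - 1) - of_real a)) \<longlonglongrightarrow> 0" .
    show "\<forall>\<^sub>F n in sequentially. norm (z n ^ n - w n ^ n) \<le> norm (of_nat n * (z n - 1) - of_real a)"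
      \<comment> \<open>From here on n is positive and \<open>a / n\<close> lies between -1 and 0,
        which puts \<open>w n\<close> in the unit disc.\<close>
      using eventually_ge_at_top[of "nat \<lceil>- a\<rceil> + 1"]
    proof eventually_elim
      case (elim n)
      then have n: "real n \<ge> - a" "n > 0" by linarith+
      have "norm (w n) \<le> 1"
        unfolding w_def norm_of_real using n \<open>a \<le> 0\<close> by (auto simp: field_simps abs_le_iff)
      then have "norm (z n ^ n - w n ^ n) \<le> n * norm (z n - w n)"
        using assms(3) by (intro norm_power_diff)
      also have "\<dots> = norm (of_nat n * (z n - w n))"
        by (simp add: norm_mult)
      also have "of_nat n * (z n - w n) = of_nat n * (z n - 1) - of_real a"
        using n by (simp add: w_def field_simps)
      finally show ?case .
    qed
  qed
  from tendsto_add[OF this w] show ?thesis by simp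
qed

text \<open>The Taylor remainder of third order is at most \<open>\<bar>f x\<bar>^3 / 6\<close>; one
  factor is bounded by \<open>K\<close>. For summands bounded by constants tending to 0, with second
  moments of order 1/n, the error is o(1/n), in the manner of a Lindeberg condition.\<close>

lemma (in prob_space) expectation_iexp_approx:
  assumes [measurable]: "f \<in> borel_measurable M" and K: "\<And>x. x \<in> space M \<Longrightarrow> \<bar>f x\<bar> \<le> K"
  shows "norm ((\<integral>x. iexp (f x) \<partial>M) - (1 + \<i> * of_real (\<integral>x. f x \<partial>M) - of_real (\<integral>x. (f x)\<^sup>2 \<partial>M) / 2))
    \<le> K / 6 * (\<integral>x. (f x)\<^sup>2 \<partial>M)"
proof -
  have i1: "integrable M f"
    by (rule integrable_const_bound[where B=K]) (use K in auto)
  have i2: "integrable M (\<lambda>x. (f x)\<^sup>2)"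
  proof (rule integrable_const_bound[where B="K\<^sup>2"])
    show "AE x in M. norm ((f x)\<^sup>2) \<le> K\<^sup>2"
      using K by (intro AE_I2) (metis abs_le_square_iff abs_ge_zero abs_of_nonneg norm_power order_trans real_norm_def power_mono)
  qed simp
  have ie: "integrable M (\<lambda>x. iexp (f x))"
    by (intro integrable_iexp) auto
  let ?g = "\<lambda>x. iexp (f x) - (1 + \<i> * of_real (f x) - of_real ((f x)\<^sup>2) / 2)"
  have j: "integrable M (\<lambda>x. 1 :: complex)" "integrable M (\<lambda>x. \<i> * complex_of_real (f x))"
    "integrable M (\<lambda>x. complex_of_real ((f x)\<^sup>2) / 2)"
    by (simp, intro integrable_mult_right integrable_of_real i1, intro integrable_divide integrable_of_real i2)
  note j12 = Bochner_Integration.integrable_add[OF j(1,2)]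
  note j123 = Bochner_Integration.integrable_diff[OF j12 j(3)]
  note ig = Bochner_Integration.integrable_diff[OF ie j123]
  have "(\<integral>x. iexp (f x) \<partial>M) - (1 + \<i> * of_real (\<integral>x. f x \<partial>M) - of_real (\<integral>x. (f x)\<^sup>2 \<partial>M) / 2)
     = (\<integral>x. ?g x \<partial>M)"
    unfolding Bochner_Integration.integral_diff[OF ie j123] Bochner_Integration.integral_diff[OF j12 j(3)]
      Bochner_Integration.integral_add[OF j(1,2)] integral_mult_right_zero integral_divide_zero
      integral_complex_of_real
    using prob_space by simp
  also have "norm (\<integral>x. ?g x \<partial>M) \<le> (\<integral>x. norm (?g x) \<partial>M)"
    by (rule integral_norm_bound)
  also have "\<dots> \<le> (\<integral>x. K / 6 * (f x)\<^sup>2 \<partial>M)"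
  proof (rule integral_mono)
    fix x assume "x \<in> space M"
    have "norm (?g x) \<le> \<bar>f x\<bar>^3 / 6"
      using iexp_approx1[of "f x" 2]
      by (simp add: numeral_eq_Suc fact_reduce power_mult_distrib algebra_simps)
    also have "\<dots> = \<bar>f x\<bar> * (f x)\<^sup>2 / 6"
      by (simp add: power2_eq_square power3_eq_cube)
    also have "\<dots> \<le> K * (f x)\<^sup>2 / 6"
      using K[OF \<open>x \<in> space M\<close>] by (intro divide_right_mono mult_right_mono) auto
    finally show "norm (?g x) \<le> K / 6 * (f x)\<^sup>2" by simp
  qed (use ig i2 in auto)
  also have "\<dots> = K / 6 * (\<integral>x. (f x)\<^sup>2 \<partial>M)" by simp
  finally show ?thesis .
qed

text \<open>Takes the place of Slutsky's theorem. At \<open>d = 0\<close> the quotient is \<open>0\<close> and the bound is trivial.\<close>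

lemma abs_exp_divide_diff_le:
  fixes q d s :: real
  assumes "0 \<le> q" "0 \<le> d" "0 \<le> s"
  shows "\<bar>exp (- (s * (q / d))) - exp (- (s * q))\<bar> \<le> 2 * \<bar>d - 1\<bar>"
proof -
  \<comment> \<open>This bound depends only on the ratio of the exponents, so it is uniform in
    \<open>q\<close>, which is unbounded in the application.\<close>
  have key: "exp (- a) - exp (- b) \<le> b / a - 1" if "0 < a" "a \<le> b" for a b :: real
  proof -
    have "1 - exp (- (b - a)) \<le> b - a" using exp_ge_add_one_self[of "- (b - a)"] by linarith
    then have "exp (- a) * (1 - exp (- (b - a))) \<le> exp (- a) * (b - a)"
      by (intro mult_left_mono) auto
    moreover have "exp (- a) * (1 - exp (- (b - a))) = exp (- a) - exp (- b)"
      by (simp add: right_diff_distrib exp_add[symmetric])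
    moreover have "exp (- a) \<le> 1 / a"
    proof -
      have "a \<le> exp a" using exp_ge_add_one_self[of a] by linarith
      then show ?thesis using that by (simp add: exp_minus field_simps)
    qed
    then have "exp (- a) * (b - a) \<le> 1 / a * (b - a)"
      using that by (intro mult_right_mono) auto
    moreover have "1 / a * (b - a) = b / a - 1" using that by (simp add: field_simps)
    ultimately show ?thesis by linarith
  qed
  have bd: "\<bar>exp (- x) - exp (- y)\<bar> \<le> 1" if "0 \<le> x" "0 \<le> y" for x y :: real
  proof -
    have "exp (- x) \<le> 1" "exp (- y) \<le> 1" "0 < exp (- x)" "0 < exp (- y)" using that by auto
    then show ?thesis by linarith
  qed
  \<comment> \<open>For \<open>d < 1/2\<close> the right side exceeds 1, which bounds any difference
    of such exponentials. For \<open>d \<ge> 1/2\<close> and a positive exponent, \<open>key\<close>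
    applies, and the factor 2 absorbs \<open>1 / d\<close>.\<close>
  consider "d < 1/2" | "s * q = 0" | "d \<ge> 1/2" "s * q > 0"
    using assms by (metis linorder_not_le mult_nonneg_nonneg order_le_less)
  then show ?thesis
  proof cases
    case 1
    then show ?thesis using bd[of "s * (q / d)" "s * q"] assms by auto
  next
    case 2
    then have "s * (q / d) = 0" by auto
    then show ?thesis by (simp only: 2) simp
  next
    case 3
    then have d: "0 < d" and nz: "s \<noteq> 0" "q \<noteq> 0" by auto
    have sq: "s * (q / d) = s * q / d" by simp
    show ?thesis
    proof (cases "d \<le> 1")
      case True
      have "s * q \<le> s * q / d" using 3 True d by (simp add: le_divide_eq mult_left_le)
      then have "\<bar>exp (- (s * (q / d))) - exp (- (s * q))\<bar> = exp (- (s * q)) - exp (- (s * q / d))"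
        by simp
      also have "\<dots> \<le> (s * q / d) / (s * q) - 1"
        using 3 \<open>s * q \<le> s * q / d\<close> by (intro key) auto
      also have "\<dots> = (1 - d) / d" using nz d by (simp add: field_simps)
      also have "\<dots> \<le> 2 * (1 - d)"
      proof -
        have "(1 - d) * 1 \<le> (1 - d) * (2 * d)" using 3 True by (intro mult_left_mono) auto
        then show ?thesis by (subst pos_divide_le_eq[OF d]) (simp add: algebra_simps)
      qed
      finally show ?thesis using True by simp
    next
      case False
      have "s * q * 1 \<le> s * q * d" using 3 False by (intro mult_left_mono) auto
      then have le: "s * q / d \<le> s * q" using d by (simp add: divide_le_eq)
      then have "\<bar>exp (- (s * (q / d))) - exp (- (s * q))\<bar> = exp (- (s * q / d)) - exp (- (s * q))"
        by simp
      also have "\<dots> \<le> (s * q) / (s * q / d) - 1"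
        using 3 d le by (intro key) auto
      also have "\<dots> = d - 1" using nz d by (simp add: field_simps)
      finally show ?thesis using False by simp
    qed
  qed
qed

section \<open>Diagonalization of the covariance of centered partial sums\<close>

text \<open>Dirichlet kernel: multiplication by \<open>2 * sin (x / 2)\<close> turns each cosine
  into a difference of sines, and the sum telescopes.\<close>

lemma sum_cos_multiples:
  fixes x :: real
  assumes "n \<ge> 1"
  shows "2 * sin (x / 2) * (\<Sum>t<n. cos (real t * x)) = sin (real n * x - x / 2) + sin (x / 2)"
  using assms
proof (induction n rule: nat_induct_at_least)
  case base
  then show ?case by simp
next
  case (Suc n)
  have "2 * sin (x / 2) * cos (real n * x) = sin (real n * x + x / 2) - sin (real n * x - x / 2)"
    by (simp add: sin_add sin_diff)
  moreover have "real (Suc n) * x - x / 2 = real n * x + x / 2"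
    by (simp add: algebra_simps)
  ultimately show ?case using Suc by (simp add: distrib_left add.commute)
qed

text \<open>Common source of the sine and cosine orthogonality relations: outside the resonant case
  the value depends only on the parity of \<open>m\<close>, so sums at two frequencies can be
  compared by parity alone.\<close>

lemma sum_cos_pi_div:
  fixes m :: int
  assumes "k \<ge> 1"
  shows "(\<Sum>t<k. cos (real t * (pi * m / k))) = (if 2 * int k dvd m then real k else if even m then 0 else 1)"
proof (cases "2 * int k dvd m")
  case True
  then obtain z where z: "m = 2 * int k * z" by blast
  have "cos (real t * (pi * m / k)) = 1" for t
  proof -
    have "real t * (pi * m / k) = 2 * of_int (int t * z) * pi" using assms by (simp add: z)
    then show ?thesis by (metis cos_int_2pin mult.assoc mult.commute)
  qed
  then show ?thesis using True by simp
next
  case False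
  \<comment> \<open>Half the angle, the argument of the sine in the Dirichlet kernel; it is a
    multiple of \<open>pi\<close> only if \<open>2 * k\<close> divides \<open>m\<close>.\<close>
  define \<theta> where "\<theta> = pi * m / k / 2"
  have s: "sin \<theta> \<noteq> 0"
  proof
    assume "sin \<theta> = 0"
    then obtain i :: int where "\<theta> = of_int i * pi" using sin_zero_iff_int2 by blast
    then have "real_of_int m = of_int (2 * int k * i)" using assms by (simp add: \<theta>_def field_simps)
    then have "m = 2 * int k * i" by linarith
    then show False using False by simp
  qed
  have "real k * (pi * m / k) - \<theta> = of_int m * pi - \<theta>" using assms by simp
  moreover have "sin (of_int m * pi - \<theta>) = - cos (of_int m * pi) * sin \<theta>"
    by (simp add: sin_diff sin_times_pi_eq_0)
  moreover have "cos (of_int m * pi) = (if even m then 1 else -1)"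
    by (simp add: cos_npi_int mult.commute[of _ pi])
  ultimately have "2 * sin \<theta> * (\<Sum>t<k. cos (real t * (pi * m / k))) = sin \<theta> - (if even m then 1 else -1) * sin \<theta>"
    using sum_cos_multiples[OF assms, of "pi * m / k"] unfolding \<theta>_def[symmetric] by simp
  also have "\<dots> = 2 * sin \<theta> * (if even m then 0 else 1)" by simp
  finally show ?thesis using s False by simp
qed

text \<open>Together with the normalized constant vector, the vectors \<open>(dct k i j)\<^sub>j\<close> for \<open>1 \<le> i < k\<close> are an orthonormal
  basis: the eigenvectors of the Laplacian of the path with vertices \<open>1, \<dots>, k\<close>, whose nonzero eigenvalues
  are the inverses of the numbers below.\<close>

definition dct :: "nat \<Rightarrow> nat \<Rightarrow> nat \<Rightarrow> real" where
  "dct k i j = sqrt (2 / real k) * cos (pi * real i / real k * (real j - 1 / 2))"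

definition dct_eigenvalue :: "nat \<Rightarrow> nat \<Rightarrow> real" where
  "dct_eigenvalue k i = 1 / (4 * (sin (real i / real k * (pi / 2)))\<^sup>2)"

lemma sin_half_angle_pos:
  assumes "i \<in> {1..k-1}"
  shows "sin (real i / real k * (pi / 2)) > 0"
proof (rule sin_gt_zero)
  have "real i / real k < 1" using assms by auto
  then have "real i / real k * (pi/2) < 1 * (pi/2)" by (intro mult_strict_right_mono) auto
  then show "real i / real k * (pi/2) < pi" using pi_gt_zero by linarith
qed (use assms in auto)

text \<open>The tail sums telescope, since \<open>cos (x (j - 1/2))\<close> is proportional to the difference
  \<open>sin (x j) - sin (x (j - 1))\<close>.\<close>

lemma sum_dct_tail:
  assumes i: "i \<in> {1..k-1}" and m: "m \<in> {1..k}"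
  shows "(\<Sum>j=m..k. dct k i j) =
    - sqrt (2 / real k) / (2 * sin (real i / real k * (pi / 2))) * sin (pi * real i / real k * (real m - 1))"
proof -
  define x where "x = pi * real i / real k"
  have sx: "sin (real i / real k * (pi / 2)) = sin (x / 2)"
    by (simp add: x_def field_simps)
  have s: "sin (x / 2) > 0" using sin_half_angle_pos[OF i] sx by simp
  have tele: "2 * sin (x / 2) * (\<Sum>j=m..k. cos (x * (real j - 1 / 2))) = sin (x * k) - sin (x * (real m - 1))"
  proof -
    have "2 * sin (x / 2) * cos (x * (real j - 1 / 2)) = sin (x * j) - sin (x * (real j - 1))" for j
    proof -
      have "x * j = x * (real j - 1 / 2) + x / 2" "x * (real j - 1) = x * (real j - 1 / 2) - x / 2"
        by (simp_all add: algebra_simps)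
      then show ?thesis by (simp only: sin_add sin_diff) simp
    qed
    then have "2 * sin (x / 2) * (\<Sum>j=m..k. cos (x * (real j - 1 / 2))) =
       (\<Sum>j=m..k. sin (x * j) - sin (x * (real j - 1)))"
      by (simp add: sum_distrib_left)
    also have "\<dots> = (\<Sum>j=m..k. sin (x * (real (Suc j) - 1)) - sin (x * (real j - 1)))" by simp
    also have "\<dots> = sin (x * (real (Suc k) - 1)) - sin (x * (real m - 1))"
      using m by (intro sum_Suc_diff) auto
    finally show ?thesis by simp
  qed
  \<comment> \<open>The upper end of the telescoping sum vanishes, so only the term at
    \<open>m - 1\<close> survives.\<close>
  have "x * k = pi * i" using i by (cases k) (auto simp: x_def)
  then have "sin (x * k) = 0" by (simp add: mult.commute)
  with tele s have "(\<Sum>j=m..k. cos (x * (real j - 1 / 2))) = - sin (x * (real m - 1)) / (2 * sin (x / 2))"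
    by (simp add: field_simps)
  then have "(\<Sum>j=m..k. dct k i j) = sqrt (2 / real k) * (- sin (x * (real m - 1)) / (2 * sin (x / 2)))"
    by (simp add: dct_def x_def sum_distrib_left[symmetric])
  then show ?thesis unfolding sx x_def[symmetric] by simp
qed

text \<open>Orthogonality to constants, which later removes the common mean of the weighted
  counts.\<close>

lemma sum_dct_eq_0: "i \<in> {1..k-1} \<Longrightarrow> (\<Sum>j=1..k. dct k i j) = 0"
  using sum_dct_tail[of i k 1] by auto

text \<open>The product formula gives cosine sums at the frequencies \<open>i - i'\<close> and
  \<open>i + i'\<close>. These have equal parity, so the nonresonant values cancel; only
  \<open>i - i' = 0\<close> can be resonant, since \<open>i + i'\<close> lies strictly between 0 and
  \<open>2 * k\<close>.\<close>

lemma sin_orthogonal: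
  assumes i: "i \<in> {1..k-1}" and i': "i' \<in> {1..k-1}"
  shows "(\<Sum>m=1..k. sin (pi * real i / real k * (real m - 1)) * sin (pi * real i' / real k * (real m - 1)))
    = (if i = i' then real k / 2 else 0)"
proof -
  have k: "k \<ge> 1" using i by auto
  \<comment> \<open>The shift \<open>t = m - 1\<close> brings the sum to the range 0 to
    \<open>k - 1\<close> of the cosine sums.\<close>
  have "(\<Sum>m=1..k. sin (pi * real i / real k * (real m - 1)) * sin (pi * real i' / real k * (real m - 1)))
    = (\<Sum>t<k. sin (pi * real i / real k * t) * sin (pi * real i' / real k * t))"
    by (rule sum.reindex_bij_witness[of _ Suc "\<lambda>m. m - 1"]) auto
  also have "\<dots> = (\<Sum>t<k. (cos (real t * (pi * (int i - int i') / k)) - cos (real t * (pi * (int i + int i') / k))) / 2)"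
    by (intro sum.cong refl, subst sin_times_sin) (simp add: field_simps)
  also have "\<dots> = ((\<Sum>t<k. cos (real t * (pi * (int i - int i') / k))) - (\<Sum>t<k. cos (real t * (pi * (int i + int i') / k)))) / 2"
    by (simp add: sum_subtractf sum_divide_distrib[symmetric])
  also have "\<dots> = (if i = i' then real k / 2 else 0)"
  proof -
    have a: "\<not> 2 * int k dvd int i + int i'"
      using i i' by (intro zdvd_not_zless) auto
    have b: "2 * int k dvd int i - int i' \<longleftrightarrow> i = i'"
    proof
      assume "2 * int k dvd int i - int i'"
      moreover have "\<bar>int i - int i'\<bar> < 2 * int k" using i i' by auto
      ultimately have "int i - int i' = 0"
        using dvd_imp_le_int[of "int i - int i'" "2 * int k"] by linarith
      then show "i = i'" by simp
    qed simp
    have c: "even (int i - int i') = even (int i + int i')" by simp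
    show ?thesis
      using sum_cos_pi_div[OF k, of "int i - int i'"] sum_cos_pi_div[OF k, of "int i + int i'"] a b c
      by (auto simp only: of_int_add of_int_diff of_int_of_nat_eq if_True if_False split: if_splits; simp)
  qed
  finally show ?thesis .
qed

lemma sum_swap3:
  "(\<Sum>m\<in>A. \<Sum>i\<in>B. \<Sum>j\<in>C. f m i j) = (\<Sum>i\<in>B. \<Sum>j\<in>C. \<Sum>m\<in>A. f m i j)"
  by (subst sum.swap) (intro sum.cong refl sum.swap)

text \<open>\<open>min j l\<close> counts the \<open>m \<ge> 1\<close> with \<open>m \<le> j\<close>
  and \<open>m \<le> l\<close>; this writes the covariance of a random walk through its independent
  increments.\<close>

lemma sum_swap_min:
  fixes a b :: "nat \<Rightarrow> real"
  shows "(\<Sum>j=1..k. \<Sum>l=1..k. a j * b l * real (min j l)) = (\<Sum>m=1..k. (\<Sum>j=m..k. a j) * (\<Sum>l=m..k. b l))"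
proof -
  have "(\<Sum>m=1..k. (\<Sum>j=m..k. a j) * (\<Sum>l=m..k. b l))
     = (\<Sum>m=1..k. \<Sum>j=1..k. \<Sum>l=1..k. if m \<le> j \<and> m \<le> l then a j * b l else 0)"
  proof (rule sum.cong[OF refl])
    fix m assume "m \<in> {1..k}"
    have t: "(\<Sum>j=m..k. f j) = (\<Sum>j=1..k. if m \<le> j then f j else 0)" for f :: "nat \<Rightarrow> real"
      using \<open>m \<in> {1..k}\<close> by (intro sum.mono_neutral_cong_left) auto
    show "(\<Sum>j=m..k. a j) * (\<Sum>l=m..k. b l) = (\<Sum>j=1..k. \<Sum>l=1..k. if m \<le> j \<and> m \<le> l then a j * b l else 0)"
      unfolding t sum_product by (intro sum.cong) auto
  qed
  also have "\<dots> = (\<Sum>j=1..k. \<Sum>l=1..k. \<Sum>m=1..k. if m \<le> j \<and> m \<le> l then a j * b l else 0)"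
    by (rule sum_swap3)
  also have "\<dots> = (\<Sum>j=1..k. \<Sum>l=1..k. a j * b l * real (min j l))"
  proof (intro sum.cong refl)
    fix j l assume "j \<in> {1..k}" "l \<in> {1..k}"
    then have "(\<Sum>m=1..k. if m \<le> j \<and> m \<le> l then a j * b l else 0) = (\<Sum>m=1..min j l. a j * b l)"
      by (intro sum.mono_neutral_cong_right) auto
    then show "(\<Sum>m=1..k. if m \<le> j \<and> m \<le> l then a j * b l else 0) = a j * b l * real (min j l)"
      by (simp add: mult.commute)
  qed
  finally show ?thesis by simp
qed

text \<open>By \<open>sum_swap_min\<close> the form is the sum of squared tail sums of
  \<open>a\<close>. These are combinations of sines, and sine orthogonality removes all mixed
  terms.\<close>

lemma dct_min_quadratic_form:
  fixes u :: "nat \<Rightarrow> real" and k :: nat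
  defines "a \<equiv> \<lambda>j. \<Sum>i=1..k-1. u i * dct k i j"
  shows "(\<Sum>j=1..k. \<Sum>l=1..k. a j * a l * real (min j l)) = (\<Sum>i=1..k-1. dct_eigenvalue k i * (u i)\<^sup>2)"
proof -
  \<comment> \<open>The factor from \<open>sum_dct_tail\<close>; its square times
    \<open>k / 2\<close>, the squared norm of the sine vector, is the eigenvalue.\<close>
  define h where "h i = - sqrt (2 / real k) / (2 * sin (real i / real k * (pi / 2)))" for i
  define S where "S i m = sin (pi * real i / real k * (real m - 1))" for i m :: nat
  have tail: "(\<Sum>j=m..k. a j) = (\<Sum>i=1..k-1. u i * h i * S i m)" if "m \<in> {1..k}" for m
  proof -
    have "(\<Sum>j=m..k. a j) = (\<Sum>i=1..k-1. u i * (\<Sum>j=m..k. dct k i j))"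
      unfolding a_def by (subst sum.swap) (simp add: sum_distrib_left)
    also have "\<dots> = (\<Sum>i=1..k-1. u i * (h i * S i m))"
      unfolding h_def S_def using that sum_dct_tail by (intro sum.cong refl) auto
    finally show ?thesis by (simp add: mult.assoc)
  qed
  have "(\<Sum>j=1..k. \<Sum>l=1..k. a j * a l * real (min j l))
     = (\<Sum>m=1..k. (\<Sum>i=1..k-1. u i * h i * S i m) * (\<Sum>i=1..k-1. u i * h i * S i m))"
    unfolding sum_swap_min using tail by (intro sum.cong) auto
  also have "\<dots> = (\<Sum>m=1..k. \<Sum>i=1..k-1. \<Sum>i'=1..k-1. (u i * h i) * (u i' * h i') * (S i m * S i' m))"
    by (simp add: sum_product mult_ac)
  also have "\<dots> = (\<Sum>i=1..k-1. \<Sum>i'=1..k-1. (u i * h i) * (u i' * h i') * (\<Sum>m=1..k. S i m * S i' m))"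
    by (simp only: sum_distrib_left) (rule sum_swap3)
  also have "\<dots> = (\<Sum>i=1..k-1. \<Sum>i'=1..k-1. (u i * h i) * (u i' * h i') * (if i = i' then real k / 2 else 0))"
    unfolding S_def using sin_orthogonal by (intro sum.cong refl) auto
  also have "\<dots> = (\<Sum>i=1..k-1. (u i * h i)\<^sup>2 * (real k / 2))"
    by (intro sum.cong refl) (simp add: power2_eq_square if_distrib[of "\<lambda>z. _ * z"] cong: if_cong)
  also have "\<dots> = (\<Sum>i=1..k-1. dct_eigenvalue k i * (u i)\<^sup>2)"
  proof (intro sum.cong refl)
    fix i assume i: "i \<in> {1..k-1}"
    have "(h i)\<^sup>2 * (real k / 2) = dct_eigenvalue k i"
      using i by (simp add: h_def dct_eigenvalue_def power_divide power_mult_distrib)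
    then show "(u i * h i)\<^sup>2 * (real k / 2) = dct_eigenvalue k i * (u i)\<^sup>2"
      by (simp add: power_mult_distrib mult_ac)
  qed
  finally show ?thesis .
qed

text \<open>Completeness of the basis: \<open>- 1 / k\<close> accounts for the missing normalized
  constant vector. The frequencies \<open>j - l\<close> and \<open>j + l - 1\<close> have opposite
  parity, so off the diagonal the two full cosine sums add up to 1, and on it to
  \<open>k + 1\<close>.\<close>

lemma dct_column_product:
  assumes j: "j \<in> {1..k}" and l: "l \<in> {1..k}"
  shows "(\<Sum>i=1..k-1. dct k i j * dct k i l) = (if j = l then 1 else 0) - 1 / real k"
proof -
  have k: "k \<ge> 1" using j by auto
  \<comment> \<open>The cosine sums start at index 0, where every term is 1; splitting it off
    subtracts 2 in total.\<close>
  have "{..<k} = insert 0 {1..k-1}" using k by auto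
  then have split: "(\<Sum>i<k. f i) = f 0 + (\<Sum>i=1..k-1. f i)" for f :: "nat \<Rightarrow> real" by simp
  have "(\<Sum>i=1..k-1. dct k i j * dct k i l)
      = (\<Sum>i=1..k-1. 1 / k * (cos (real i * (pi * (int j - int l) / k)) + cos (real i * (pi * (int j + int l - 1) / k))))"
  proof (intro sum.cong refl)
    fix i
    have "dct k i j * dct k i l = 2 / k *
        (cos (pi * real i / real k * (real j - 1 / 2)) * cos (pi * real i / real k * (real l - 1 / 2)))"
    proof -
      have "dct k i j * dct k i l = (sqrt (2 / k) * sqrt (2 / k)) *
        (cos (pi * real i / real k * (real j - 1 / 2)) * cos (pi * real i / real k * (real l - 1 / 2)))"
        by (simp only: dct_def mult_ac)
      then show ?thesis by simp
    qed
    also have "\<dots> = 1 / k * (cos (real i * (pi * (int j - int l) / k)) + cos (real i * (pi * (int j + int l - 1) / k)))"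
    proof -
      have "pi * real i / real k * (real j - 1 / 2) - pi * real i / real k * (real l - 1 / 2)
          = real i * (pi * (int j - int l) / k)"
        and "pi * real i / real k * (real j - 1 / 2) + pi * real i / real k * (real l - 1 / 2)
          = real i * (pi * (int j + int l - 1) / k)"
        using k by (simp_all add: field_simps)
      moreover have "2 / k * ((x + y) / 2) = 1 / k * (x + y)" for x y :: real
        using k by (simp add: field_simps)
      ultimately show ?thesis by (simp only: cos_times_cos)
    qed
    finally show "dct k i j * dct k i l = 1 / k * (cos (real i * (pi * (int j - int l) / k)) + cos (real i * (pi * (int j + int l - 1) / k)))" .
  qed
  also have "\<dots> = 1 / k * ((\<Sum>i<k. cos (real i * (pi * (int j - int l) / k))) - 1
        + ((\<Sum>i<k. cos (real i * (pi * (int j + int l - 1) / k))) - 1))"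
    unfolding split sum_distrib_left[symmetric] sum.distrib by simp
  also have "\<dots> = (if j = l then 1 else 0) - 1 / real k"
  proof -
    have a: "\<not> 2 * int k dvd int j + int l - 1"
      using j l by (intro zdvd_not_zless) auto
    have b: "2 * int k dvd int j - int l \<longleftrightarrow> j = l"
    proof
      assume "2 * int k dvd int j - int l"
      moreover have "\<bar>int j - int l\<bar> < 2 * int k" using j l by auto
      ultimately have "int j - int l = 0"
        using dvd_imp_le_int[of "int j - int l" "2 * int k"] by linarith
      then show "j = l" by simp
    qed simp
    have c: "even (int j - int l) \<longleftrightarrow> \<not> even (int j + int l - 1)" by simp
    show ?thesis
      using sum_cos_pi_div[OF k, of "int j - int l"] sum_cos_pi_div[OF k, of "int j + int l - 1"] a b c k
      by (auto simp: field_simps split: if_splits)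
  qed
  finally show ?thesis .
qed

text \<open>Parseval's identity: centering projects onto the complement of the constants, which the
  vectors \<open>dct k i\<close> span orthonormally.\<close>

lemma sum_squares_centered_dct:
  fixes y :: "nat \<Rightarrow> real"
  shows "(\<Sum>j=1..k. (y j - 1 / real k * (\<Sum>l=1..k. y l))\<^sup>2) = (\<Sum>i=1..k-1. (\<Sum>j=1..k. dct k i j * y j)\<^sup>2)"
proof (cases "k = 0")
  case False
  define s where "s = (\<Sum>l=1..k. y l)"
  have "(\<Sum>i=1..k-1. (\<Sum>j=1..k. dct k i j * y j)\<^sup>2)
     = (\<Sum>i=1..k-1. \<Sum>j=1..k. \<Sum>l=1..k. y j * y l * (dct k i j * dct k i l))"
    by (simp add: power2_eq_square sum_product mult_ac)
  also have "\<dots> = (\<Sum>j=1..k. \<Sum>l=1..k. y j * y l * (\<Sum>i=1..k-1. dct k i j * dct k i l))"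
    by (simp only: sum_distrib_left) (rule sum_swap3)
  also have "\<dots> = (\<Sum>j=1..k. \<Sum>l=1..k. y j * y l * (if j = l then 1 else 0) - y j * y l * (1 / real k))"
    using dct_column_product by (intro sum.cong refl) (simp add: right_diff_distrib)
  also have "\<dots> = (\<Sum>j=1..k. (y j)\<^sup>2) - s\<^sup>2 / k"
    by (simp add: sum_subtractf s_def power2_eq_square sum_product sum_divide_distrib
        if_distrib[of "\<lambda>z. _ * z"] cong: if_cong)
  also have "\<dots> = (\<Sum>j=1..k. (y j - 1 / real k * s)\<^sup>2)"
  proof -
    have "(\<Sum>j=1..k. (y j - 1 / real k * s)\<^sup>2) = (\<Sum>j=1..k. (y j)\<^sup>2 - 2 * (1 / real k * s) * y j + (1 / real k * s)\<^sup>2)"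
      by (simp add: power2_diff algebra_simps)
    also have "\<dots> = (\<Sum>j=1..k. (y j)\<^sup>2) - 2 * (1 / real k * s) * s + real k * (1 / real k * s)\<^sup>2"
      by (simp only: sum.distrib sum_subtractf sum_distrib_left[symmetric] s_def[symmetric]) simp
    also have "\<dots> = (\<Sum>j=1..k. (y j)\<^sup>2) - s\<^sup>2 / k"
      using False by (simp add: power2_eq_square field_simps)
    finally show ?thesis by simp
  qed
  finally show ?thesis by (simp add: s_def)
qed simp

section \<open>Counts of nested rare events\<close>

lemma (in prob_space) expectation_square_sum_indep:
  fixes Y :: "'i \<Rightarrow> 'a \<Rightarrow> real"
  assumes I: "finite I" "indep_vars (\<lambda>_. borel) Y I"
    and int: "\<And>i. i \<in> I \<Longrightarrow> integrable M (Y i)" "\<And>i. i \<in> I \<Longrightarrow> integrable M (\<lambda>x. (Y i x)\<^sup>2)"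
    and zero: "\<And>i. i \<in> I \<Longrightarrow> expectation (Y i) = 0"
  shows "integrable M (\<lambda>x. (\<Sum>i\<in>I. Y i x)\<^sup>2)"
    and "expectation (\<lambda>x. (\<Sum>i\<in>I. Y i x)\<^sup>2) = (\<Sum>i\<in>I. expectation (\<lambda>x. (Y i x)\<^sup>2))"
proof -
  have off_diagonal: "integrable M (\<lambda>x. Y i x * Y j x)" "expectation (\<lambda>x. Y i x * Y j x) = 0"
    if "i \<in> I" "j \<in> I" "i \<noteq> j" for i j
  proof -
    have "indep_vars (\<lambda>_. borel) Y {i, j}" using that by (intro indep_vars_subset[OF I(2)]) auto
    from indep_vars_integrable[OF _ this] indep_vars_lebesgue_integral[OF _ this] that int(1) zero
    show "integrable M (\<lambda>x. Y i x * Y j x)" "expectation (\<lambda>x. Y i x * Y j x) = 0" by auto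
  qed
  have ip: "integrable M (\<lambda>x. Y i x * Y j x)" if "i \<in> I" "j \<in> I" for i j
    using that int(2) off_diagonal by (cases "i = j") (auto simp: power2_eq_square)
  have ep: "expectation (\<lambda>x. Y i x * Y j x) = (if i = j then expectation (\<lambda>x. (Y i x)\<^sup>2) else 0)"
    if "i \<in> I" "j \<in> I" for i j
    using that off_diagonal by (auto simp: power2_eq_square)
  have sq: "(\<Sum>i\<in>I. Y i x)\<^sup>2 = (\<Sum>i\<in>I. \<Sum>j\<in>I. Y i x * Y j x)" for x
    by (simp add: power2_eq_square sum_product)
  show "integrable M (\<lambda>x. (\<Sum>i\<in>I. Y i x)\<^sup>2)"
    unfolding sq using ip by auto
  have "expectation (\<lambda>x. (\<Sum>i\<in>I. Y i x)\<^sup>2) = (\<Sum>i\<in>I. \<Sum>j\<in>I. expectation (\<lambda>x. Y i x * Y j x))"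
    unfolding sq using ip by (simp add: Bochner_Integration.integral_sum)
  also have "\<dots> = (\<Sum>i\<in>I. \<Sum>j\<in>I. if i = j then expectation (\<lambda>x. (Y i x)\<^sup>2) else 0)"
    using ep by (intro sum.cong refl)
  also have "\<dots> = (\<Sum>i\<in>I. expectation (\<lambda>x. (Y i x)\<^sup>2))"
    using I(1) by simp
  finally show "expectation (\<lambda>x. (\<Sum>i\<in>I. Y i x)\<^sup>2) = (\<Sum>i\<in>I. expectation (\<lambda>x. (Y i x)\<^sup>2))" .
qed

text \<open>The variance of \<open>\<bar>Y\<bar>\<close> is nonnegative.\<close>

lemma (in prob_space) expectation_abs_le_sqrt:
  fixes Y :: "'a \<Rightarrow> real"
  assumes "integrable M Y" "integrable M (\<lambda>x. (Y x)\<^sup>2)"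
  shows "expectation (\<lambda>x. \<bar>Y x\<bar>) \<le> sqrt (expectation (\<lambda>x. (Y x)\<^sup>2))"
proof -
  have "0 \<le> variance (\<lambda>x. \<bar>Y x\<bar>)" by (rule variance_positive)
  also have "\<dots> = expectation (\<lambda>x. (Y x)\<^sup>2) - (expectation (\<lambda>x. \<bar>Y x\<bar>))\<^sup>2"
    using assms by (subst variance_eq) auto
  finally show ?thesis by (simp add: real_le_rsqrt)
qed

text \<open>Here \<open>d n\<close> is the common first-order value of \<open>j \<nu>(A n j)\<close> for \<open>1 \<le> j \<le> k\<close>, in the application \<open>c\<^sub>n m\<^sub>D\<close>.\<close>

locale nested_array = prob_space P for P :: "'d measure" +
  fixes S \<nu> :: "'s measure" and X :: "nat \<Rightarrow> 'd \<Rightarrow> 's" and A :: "nat \<Rightarrow> nat \<Rightarrow> 's set"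
    and k :: nat and d :: "nat \<Rightarrow> real"
  assumes indep: "indep_vars (\<lambda>_. S) X {1..}"
    and law: "\<And>i. i \<ge> 1 \<Longrightarrow> distr P S (X i) = \<nu>"
    and A_sets [measurable]: "\<And>n j. A n j \<in> sets S"
    and nested: "\<And>n j l. n \<ge> 1 \<Longrightarrow> 1 \<le> j \<Longrightarrow> j \<le> l \<Longrightarrow> A n l \<subseteq> A n j"
    and k_pos: "k \<ge> 1"
    and d_pos: "\<And>n. n \<ge> 1 \<Longrightarrow> d n > 0"
    and nd_at_top: "filterlim (\<lambda>n. real n * d n) at_top sequentially"
    and bias: "\<And>j. j \<in> {1..k} \<Longrightarrow>
      (\<lambda>n. sqrt (real n / d n) * (real j * measure \<nu> (A n j) - d n)) \<longlonglongrightarrow> 0"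
begin

definition hits :: "nat \<Rightarrow> nat \<Rightarrow> 'd \<Rightarrow> real" where
  "hits n j \<omega> = (\<Sum>i=1..n. indicator (A n j) (X i \<omega>))"

text \<open>No centering is applied, since each \<open>dct k i\<close> sums to 0 over
  \<open>j\<close>. The scale is the square root of the first-order mean \<open>n * d n\<close> of
  each weighted count.\<close>

definition score :: "nat \<Rightarrow> nat \<Rightarrow> 'd \<Rightarrow> real" where
  "score n i \<omega> = (\<Sum>j=1..k. dct k i j * (real j * hits n j \<omega>)) / sqrt (real n * d n)"

text \<open>The denominator of \<open>statistic\<close>, relative to its first-order value.\<close>

definition normalized_mean :: "nat \<Rightarrow> 'd \<Rightarrow> real" where
  "normalized_mean n \<omega> = 1 / real k * (\<Sum>l=1..k. real l * hits n l \<omega>) / (real n * d n)"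

lemma X_measurable [measurable]: "i \<ge> 1 \<Longrightarrow> X i \<in> P \<rightarrow>\<^sub>M S"
  using indep unfolding indep_vars_def by auto

lemma hits_measurable [measurable]: "hits n j \<in> borel_measurable P"
  unfolding hits_def by measurable

lemma score_measurable [measurable]: "score n i \<in> borel_measurable P"
  unfolding score_def by measurable

lemma normalized_mean_measurable [measurable]: "normalized_mean n \<in> borel_measurable P"
  unfolding normalized_mean_def by measurable

lemma sets_\<nu>: "sets \<nu> = sets S"
  using law[of 1] sets_distr[of P S "X 1"] by simp

lemma prob_space_\<nu>: "prob_space \<nu>"
  using law[of 1] prob_space_distr[OF X_measurable[of 1]] by simp

lemma inverse_sqrt_nd: "(\<lambda>n. inverse (sqrt (real n * d n))) \<longlonglongrightarrow> 0"
  by (intro tendsto_inverse_0_at_top filterlim_compose[OF sqrt_at_top nd_at_top])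

text \<open>The relative error of \<open>j * \<nu>(A n j)\<close> is the bias term divided by
  \<open>sqrt (n * d n)\<close>, which tends to infinity.\<close>

lemma probability_ratio:
  assumes "j \<in> {1..k}"
  shows "(\<lambda>n. real j * measure \<nu> (A n j) / d n) \<longlonglongrightarrow> 1"
proof -
  have "(\<lambda>n. sqrt (real n / d n) * (real j * measure \<nu> (A n j) - d n) * inverse (sqrt (real n * d n)) + 1) \<longlonglongrightarrow> 0 * 0 + 1"
    by (intro tendsto_intros bias assms inverse_sqrt_nd)
  then have "(\<lambda>n. sqrt (real n / d n) * (real j * measure \<nu> (A n j) - d n) * inverse (sqrt (real n * d n)) + 1) \<longlonglongrightarrow> 1"
    by simp
  then show ?thesis
  proof (rule Lim_transform_eventually)
    show "eventually (\<lambda>n. sqrt (real n / d n) * (real j * measure \<nu> (A n j) - d n) * inverse (sqrt (real n * d n)) + 1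
      = real j * measure \<nu> (A n j) / d n) sequentially"
      using eventually_ge_at_top[of 1]
    proof eventually_elim
      case (elim n)
      then have n: "real n > 0" "d n > 0" using d_pos by auto
      have "sqrt (real n / d n) * inverse (sqrt (real n * d n)) = 1 / d n"
        using n by (simp add: real_sqrt_divide real_sqrt_mult field_simps)
      then have "sqrt (real n / d n) * (real j * measure \<nu> (A n j) - d n) * inverse (sqrt (real n * d n))
        = (real j * measure \<nu> (A n j) - d n) * (1 / d n)"
        by (metis mult.assoc mult.commute)
      then show ?case using n by (simp add: field_simps)
    qed
  qed
qed

text \<open>A central limit theorem for a triangular array: a linear form in the scores is a sum of
  n independent copies of \<open>\<eta> n\<close>, so its characteristic function is
  \<open>z n ^ n\<close>. Here n times the mean tends to 0, n times the second moment to
  \<open>\<sigma>2\<close>, and \<open>\<eta> n\<close> is bounded by \<open>K n\<close>, which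
  tends to 0.\<close>

lemma characteristic_function_score:
  fixes u :: "nat \<Rightarrow> real"
  shows "(\<lambda>n. \<integral>\<omega>. iexp (\<Sum>i=1..k-1. u i * score n i \<omega>) \<partial>P)
    \<longlonglongrightarrow> of_real (exp (- (\<Sum>i=1..k-1. dct_eigenvalue k i * (u i)\<^sup>2) / 2))"
proof -
  interpret \<nu>: prob_space \<nu> by (rule prob_space_\<nu>)
  note sets_\<nu>[measurable_cong]
  define a where "a j = (\<Sum>i=1..k-1. u i * dct k i j)" for j
  define r where "r n = sqrt (real n * d n)" for n
  define p where "p n j = measure \<nu> (A n j)" for n j
  define \<eta> where "\<eta> n x = (\<Sum>j=1..k. a j * real j * indicator (A n j) x) / r n" for n x
  define K where "K n = (\<Sum>j=1..k. \<bar>a j\<bar> * real j) * \<bar>inverse (r n)\<bar>" for n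
  define z where "z n = (\<integral>x. iexp (\<eta> n x) \<partial>\<nu>)" for n
  define \<sigma>2 where "\<sigma>2 = (\<Sum>i=1..k-1. dct_eigenvalue k i * (u i)\<^sup>2)"
  have \<eta>_meas[measurable]: "\<eta> n \<in> borel_measurable S" for n
    unfolding \<eta>_def by measurable
  have \<eta>_meas\<nu>[measurable]: "\<eta> n \<in> borel_measurable \<nu>" for n
    unfolding \<eta>_def by measurable
  \<comment> \<open>This cancels the common value \<open>d n\<close> in the mean of
    \<open>\<eta> n\<close>; what is left in \<open>lim1\<close> is a combination of the bias
    terms.\<close>
  have suma: "(\<Sum>j=1..k. a j) = 0"
  proof -
    have "(\<Sum>j=1..k. a j) = (\<Sum>i=1..k-1. u i * (\<Sum>j=1..k. dct k i j))"
      unfolding a_def sum_distrib_left by (rule sum.swap)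
    also have "\<dots> = (\<Sum>i=1..k-1. u i * 0)"
      using sum_dct_eq_0 by (intro sum.cong refl) simp
    finally show ?thesis by simp
  qed
  have linear: "(\<Sum>i=1..k-1. u i * score n i \<omega>) = (\<Sum>i=1..n. \<eta> n (X i \<omega>))" for n \<omega>
  proof -
    have "(\<Sum>i=1..k-1. u i * score n i \<omega>) = (\<Sum>j=1..k. a j * (real j * hits n j \<omega>)) / r n"
      unfolding score_def r_def[symmetric] a_def sum_distrib_right sum_divide_distrib sum_distrib_left
      by (subst sum.swap) (simp add: mult_ac)
    also have "\<dots> = (\<Sum>i=1..n. \<eta> n (X i \<omega>))"
      unfolding \<eta>_def hits_def sum_divide_distrib[symmetric] sum_distrib_left
      by (subst sum.swap) (simp add: mult_ac)
    finally show ?thesis .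
  qed
  have power: "(\<integral>\<omega>. iexp (\<Sum>i=1..k-1. u i * score n i \<omega>) \<partial>P) = z n ^ n" for n
  proof -
    have "(\<integral>\<omega>. iexp (\<Sum>i=1..k-1. u i * score n i \<omega>) \<partial>P) = (\<integral>\<omega>. (\<Prod>i=1..n. iexp (\<eta> n (X i \<omega>))) \<partial>P)"
      unfolding linear by (simp only: iexp_sum[OF finite_atLeastAtMost])
    also have "\<dots> = (\<Prod>i=1..n. \<integral>\<omega>. iexp (\<eta> n (X i \<omega>)) \<partial>P)"
    proof (rule indep_vars_lebesgue_integral)
      show "indep_vars (\<lambda>_. borel) (\<lambda>i \<omega>. iexp (\<eta> n (X i \<omega>))) {1..n}"
        by (rule indep_vars_compose2[OF indep_vars_subset[OF indep]]) auto
      show "integrable P (\<lambda>\<omega>. iexp (\<eta> n (X i \<omega>)))" if "i \<in> {1..n}" for i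
        using that by (intro integrable_iexp borel_measurable_of_real measurable_compose[OF X_measurable \<eta>_meas]) auto
    qed simp
    also have "\<dots> = (\<Prod>i=1..n. z n)"
    proof (intro prod.cong refl)
      fix i assume "i \<in> {1..n}"
      then have i: "i \<ge> 1" by simp
      have "z n = (\<integral>x. iexp (\<eta> n x) \<partial>distr P S (X i))" by (simp only: z_def law[OF i])
      also have "\<dots> = (\<integral>\<omega>. iexp (\<eta> n (X i \<omega>)) \<partial>P)"
        using i by (intro integral_distr) auto
      finally show "(\<integral>\<omega>. iexp (\<eta> n (X i \<omega>)) \<partial>P) = z n" by simp
    qed
    finally show ?thesis by simp
  qed
  have z1: "norm (z n) \<le> 1" for n
  proof -
    have "norm (z n) \<le> (\<integral>x. norm (iexp (\<eta> n x)) \<partial>\<nu>)" unfolding z_def by (rule integral_norm_bound)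
    also have "\<dots> = 1" using \<nu>.prob_space by (simp only: norm_exp_i_times) simp
    finally show ?thesis .
  qed
  have int_ind: "integrable \<nu> (indicat_real (A n j))" for n j
    using sets_\<nu> by (intro integrable_real_indicator) (auto simp: \<nu>.emeasure_eq_measure)
  have E_ind: "(\<integral>x. indicat_real (A n j) x \<partial>\<nu>) = p n j" for n j
    by (simp add: p_def sets_\<nu> sets.Int_space_eq2)
  have m1: "(\<integral>x. \<eta> n x \<partial>\<nu>) = (\<Sum>j=1..k. a j * real j * p n j) / r n" for n
    unfolding \<eta>_def integral_divide_zero
    by (subst Bochner_Integration.integral_sum)
      (intro integrable_mult_right int_ind, simp only: integral_mult_right_zero E_ind)
  have m2: "(\<integral>x. (\<eta> n x)\<^sup>2 \<partial>\<nu>) = (\<Sum>j=1..k. \<Sum>l=1..k. a j * a l * real j * real l * p n (max j l)) / (real n * d n)"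
    if "n \<ge> 1" for n
  proof -
    have rr: "(r n)\<^sup>2 = real n * d n" using d_pos[OF that] by (simp add: r_def)
    have "(\<eta> n x)\<^sup>2 = (\<Sum>j=1..k. \<Sum>l=1..k. a j * a l * real j * real l * indicator (A n (max j l)) x) / (real n * d n)" for x
    proof -
      have "(\<eta> n x)\<^sup>2 = (\<Sum>j=1..k. \<Sum>l=1..k. (a j * real j * indicator (A n j) x) * (a l * real l * indicator (A n l) x)) / (real n * d n)"
        unfolding \<eta>_def power_divide rr by (simp only: power2_eq_square sum_product)
      also have "(\<Sum>j=1..k. \<Sum>l=1..k. (a j * real j * indicator (A n j) x) * (a l * real l * indicator (A n l) x))
        = (\<Sum>j=1..k. \<Sum>l=1..k. a j * a l * real j * real l * indicator (A n (max j l)) x)"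
      proof (intro sum.cong refl)
        fix j l assume "j \<in> {1..k}" "l \<in> {1..k}"
        \<comment> \<open>As the events are nested, the intersection of two of them is the one with
          the larger index.\<close>
        then have "indicator (A n j) x * indicator (A n l) x = indicat_real (A n (max j l)) x"
          using nested[OF that, of j l] nested[OF that, of l j]
          by (cases "j \<le> l") (auto simp: indicator_def max_def)
        then show "(a j * real j * indicator (A n j) x) * (a l * real l * indicator (A n l) x)
            = a j * a l * real j * real l * indicator (A n (max j l)) x"
          by (metis (no_types, lifting) mult.assoc mult.left_commute)
      qed
      finally show ?thesis .
    qed
    then have "(\<integral>x. (\<eta> n x)\<^sup>2 \<partial>\<nu>) = (\<integral>x. (\<Sum>j=1..k. \<Sum>l=1..k.
        a j * a l * real j * real l * indicator (A n (max j l)) x) \<partial>\<nu>) / (real n * d n)"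
      by (simp only: integral_divide_zero)
    also have "(\<integral>x. (\<Sum>j=1..k. \<Sum>l=1..k. a j * a l * real j * real l * indicator (A n (max j l)) x) \<partial>\<nu>)
       = (\<Sum>j=1..k. \<integral>x. (\<Sum>l=1..k. a j * a l * real j * real l * indicator (A n (max j l)) x) \<partial>\<nu>)"
      by (intro Bochner_Integration.integral_sum Bochner_Integration.integrable_sum integrable_mult_right int_ind)
    also have "\<dots> = (\<Sum>j=1..k. \<Sum>l=1..k. a j * a l * real j * real l * p n (max j l))"
      by (subst Bochner_Integration.integral_sum)
        (intro integrable_mult_right int_ind, simp only: integral_mult_right_zero E_ind)
    finally show ?thesis .
  qed
  have lim1: "(\<lambda>n. real n * (\<integral>x. \<eta> n x \<partial>\<nu>)) \<longlonglongrightarrow> 0"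
  proof -
    have "(\<lambda>n. \<Sum>j=1..k. a j * (sqrt (real n / d n) * (real j * p n j - d n))) \<longlonglongrightarrow> (\<Sum>j=1..k. a j * 0)"
      unfolding p_def by (intro tendsto_intros bias)
    then have "(\<lambda>n. \<Sum>j=1..k. a j * (sqrt (real n / d n) * (real j * p n j - d n))) \<longlonglongrightarrow> 0" by simp
    then show ?thesis
    proof (rule Lim_transform_eventually)
      show "eventually (\<lambda>n. (\<Sum>j=1..k. a j * (sqrt (real n / d n) * (real j * p n j - d n)))
         = real n * (\<integral>x. \<eta> n x \<partial>\<nu>)) sequentially"
        using eventually_ge_at_top[of 1]
      proof eventually_elim
        case (elim n)
        then have n: "real n > 0" "d n > 0" using d_pos by auto
        have "(\<Sum>j=1..k. a j * (sqrt (real n / d n) * (real j * p n j - d n)))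
           = sqrt (real n / d n) * ((\<Sum>j=1..k. a j * real j * p n j) - d n * (\<Sum>j=1..k. a j))"
          by (simp add: sum_distrib_left sum_subtractf right_diff_distrib mult_ac)
        also have "\<dots> = sqrt (real n / d n) * (\<Sum>j=1..k. a j * real j * p n j)"
          unfolding suma by simp
        finally have "(\<Sum>j=1..k. a j * (sqrt (real n / d n) * (real j * p n j - d n)))
           = sqrt (real n / d n) * (\<Sum>j=1..k. a j * real j * p n j)" .
        moreover have "sqrt (real n / d n) = real n / r n"
          using n by (simp add: r_def real_sqrt_divide real_sqrt_mult field_simps)
        ultimately show ?case by (simp only: m1 times_divide_eq_left times_divide_eq_right)
      qed
    qed
  qed
  have lim2: "(\<lambda>n. real n * (\<integral>x. (\<eta> n x)\<^sup>2 \<partial>\<nu>)) \<longlonglongrightarrow> \<sigma>2"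
  proof -
    \<comment> \<open>The weight \<open>j * l\<close> is \<open>min j l * max j l\<close>, and the
      second factor times the probability is asymptotically \<open>d n\<close>. Thus the random-walk
      covariance \<open>min j l\<close> appears.\<close>
    have "(\<lambda>n. \<Sum>j=1..k. \<Sum>l=1..k. a j * a l * real (min j l) * (real (max j l) * p n (max j l) / d n))
        \<longlonglongrightarrow> (\<Sum>j=1..k. \<Sum>l=1..k. a j * a l * real (min j l) * 1)"
      unfolding p_def by (intro tendsto_intros probability_ratio) (auto simp: max_def)
    also have "(\<Sum>j=1..k. \<Sum>l=1..k. a j * a l * real (min j l) * 1) = \<sigma>2"
      using dct_min_quadratic_form[of u k] by (simp add: a_def \<sigma>2_def)
    finally show ?thesis
    proof (rule Lim_transform_eventually)
      show "eventually (\<lambda>n. (\<Sum>j=1..k. \<Sum>l=1..k. a j * a l * real (min j l) * (real (max j l) * p n (max j l) / d n))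
         = real n * (\<integral>x. (\<eta> n x)\<^sup>2 \<partial>\<nu>)) sequentially"
        using eventually_ge_at_top[of 1]
      proof eventually_elim
        case (elim n)
        then have n: "real n > 0" "d n > 0" using d_pos by auto
        have mm: "real (min j l) * real (max j l) = real j * real l" for j l
          by (cases "j \<le> l") (auto simp: min_def max_def)
        have h: "a j * a l * real (min j l) * (real (max j l) * p n (max j l) / d n)
           = a j * a l * real j * real l * p n (max j l) / d n" for j l
          using mm[of j l] by (simp add: mult_ac)
        show ?case unfolding h m2[OF elim] sum_divide_distrib[symmetric] using n by simp
      qed
    qed
  qed
  have K0: "K \<longlonglongrightarrow> 0"
    unfolding K_def r_def by (intro tendsto_mult_right_zero tendsto_rabs_zero inverse_sqrt_nd)
  have \<eta>K: "\<bar>\<eta> n x\<bar> \<le> K n" for n x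
  proof -
    have "\<bar>\<Sum>j=1..k. a j * real j * indicator (A n j) x\<bar> \<le> (\<Sum>j=1..k. \<bar>a j\<bar> * real j)"
      by (intro order_trans[OF sum_abs] sum_mono) (auto simp: indicator_def abs_mult)
    then show ?thesis
      unfolding \<eta>_def K_def divide_inverse abs_mult by (intro mult_right_mono) auto
  qed
  have "(\<lambda>n. of_nat n * (z n - 1)) \<longlonglongrightarrow> of_real (- \<sigma>2 / 2)"
  proof -
    let ?w = "\<lambda>n. \<i> * of_real (real n * (\<integral>x. \<eta> n x \<partial>\<nu>)) - of_real (real n * (\<integral>x. (\<eta> n x)\<^sup>2 \<partial>\<nu>)) / 2"
    have w: "?w \<longlonglongrightarrow> \<i> * of_real 0 - of_real \<sigma>2 / 2"
      by (intro tendsto_intros lim1 lim2) simp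
    have diff: "(\<lambda>n. of_nat n * (z n - 1) - ?w n) \<longlonglongrightarrow> 0"
    proof (rule Lim_null_comparison)
      show "(\<lambda>n. K n / 6 * (real n * (\<integral>x. (\<eta> n x)\<^sup>2 \<partial>\<nu>))) \<longlonglongrightarrow> 0"
        using tendsto_mult[OF tendsto_divide[OF K0 tendsto_const[of 6]] lim2] by simp
      show "eventually (\<lambda>n. norm (of_nat n * (z n - 1) - ?w n) \<le> K n / 6 * (real n * (\<integral>x. (\<eta> n x)\<^sup>2 \<partial>\<nu>))) sequentially"
      proof (rule always_eventually, rule allI)
        fix n
        let ?v = "z n - (1 + \<i> * of_real (\<integral>x. \<eta> n x \<partial>\<nu>) - of_real (\<integral>x. (\<eta> n x)\<^sup>2 \<partial>\<nu>) / 2)"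
        have "of_nat n * (z n - 1) - ?w n = of_nat n * ?v"
          by (simp add: algebra_simps)
        then have "norm (of_nat n * (z n - 1) - ?w n) = real n * norm ?v"
          by (simp only: norm_mult norm_of_nat)
        also have "\<dots> \<le> real n * (K n / 6 * (\<integral>x. (\<eta> n x)\<^sup>2 \<partial>\<nu>))"
          unfolding z_def using \<eta>K by (intro mult_left_mono \<nu>.expectation_iexp_approx) auto
        finally show "norm (of_nat n * (z n - 1) - ?w n) \<le> K n / 6 * (real n * (\<integral>x. (\<eta> n x)\<^sup>2 \<partial>\<nu>))"
          by (simp add: mult_ac)
      qed
    qed
    from tendsto_add[OF diff w] show ?thesis by simp
  qed
  moreover have "\<sigma>2 \<ge> 0" unfolding \<sigma>2_def dct_eigenvalue_def by (intro sum_nonneg) auto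
  ultimately have "(\<lambda>n. z n ^ n) \<longlonglongrightarrow> of_real (exp (- \<sigma>2 / 2))"
    using z1 by (intro tendsto_power_complex_exp) auto
  then show ?thesis unfolding power \<sigma>2_def .
qed

section \<open>Concentration of the denominator\<close>

text \<open>A Chebyshev-type argument in mean: the centered count has variance at most n times the
  probability, so its relative fluctuation is of order \<open>1 / sqrt (n * d n)\<close>; the rest
  is the bias of the probability.\<close>

lemma hits_concentration:
  assumes j: "j \<in> {1..k}"
  shows "(\<lambda>n. \<integral>\<omega>. \<bar>real j * hits n j \<omega> / (real n * d n) - 1\<bar> \<partial>P) \<longlonglongrightarrow> 0"
proof -
  interpret \<nu>: prob_space \<nu> by (rule prob_space_\<nu>)
  define p where "p n = measure \<nu> (A n j)" for n
  define b where "b n = real j / (real n * d n) * sqrt (real n * p n) + \<bar>real j * p n / d n - 1\<bar>" for n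
  have "(\<lambda>n. sqrt (real j * (real j * p n / d n)) * inverse (sqrt (real n * d n)) + \<bar>real j * p n / d n - 1\<bar>)
     \<longlonglongrightarrow> sqrt (real j * 1) * 0 + \<bar>1 - 1\<bar>"
    unfolding p_def by (intro tendsto_intros probability_ratio j inverse_sqrt_nd)
  then have "(\<lambda>n. sqrt (real j * (real j * p n / d n)) * inverse (sqrt (real n * d n)) + \<bar>real j * p n / d n - 1\<bar>) \<longlonglongrightarrow> 0"
    by simp
  moreover have "eventually (\<lambda>n. sqrt (real j * (real j * p n / d n)) * inverse (sqrt (real n * d n)) + \<bar>real j * p n / d n - 1\<bar> = b n) sequentially"
    using eventually_ge_at_top[of 1]
  proof eventually_elim
    case (elim n)
    then have n: "real n > 0" "d n > 0" using d_pos by auto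
    have "sqrt (real j * (real j * p n / d n)) * inverse (sqrt (real n * d n)) = real j / (real n * d n) * sqrt (real n * p n)"
      using n by (simp add: real_sqrt_divide real_sqrt_mult field_simps)
    then show ?case by (simp add: b_def)
  qed
  ultimately have b0: "b \<longlonglongrightarrow> 0" by (rule Lim_transform_eventually)
  show ?thesis
  proof (rule Lim_null_comparison[OF _ b0])
    show "eventually (\<lambda>n. norm (\<integral>\<omega>. \<bar>real j * hits n j \<omega> / (real n * d n) - 1\<bar> \<partial>P) \<le> b n) sequentially"
      using eventually_ge_at_top[of 1]
    proof eventually_elim
      case (elim n)
      then have n: "real n > 0" "d n > 0" using d_pos by auto
      define Y where "Y i \<omega> = indicator (A n j) (X i \<omega>) - p n" for i \<omega>
      have p01: "0 \<le> p n" "p n \<le> 1" by (auto simp: p_def)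
      have Yb: "\<bar>Y i \<omega>\<bar> \<le> 1" for i \<omega>
        using p01 by (auto simp: Y_def indicator_def)
      have Ym[measurable]: "Y i \<in> borel_measurable P" if "i \<in> {1..n}" for i
      proof -
        have [measurable]: "X i \<in> P \<rightarrow>\<^sub>M S" using that by (intro X_measurable) auto
        show ?thesis unfolding Y_def by measurable
      qed
      have Ysq: "(Y i \<omega>)\<^sup>2 \<le> 1" for i \<omega>
        using Yb abs_square_le_1 by blast
      have int: "integrable P (Y i)" "integrable P (\<lambda>\<omega>. (Y i \<omega>)\<^sup>2)" if "i \<in> {1..n}" for i
        using Ym[OF that] Yb Ysq by (auto intro!: integrable_const_bound[where B=1])
      have Xp: "expectation (\<lambda>\<omega>. indicat_real (A n j) (X i \<omega>)) = p n"
        and Xi: "integrable P (\<lambda>\<omega>. indicat_real (A n j) (X i \<omega>))" if "i \<in> {1..n}" for i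
      proof -
        have i: "i \<ge> 1" using that by simp
        have "p n = (\<integral>x. indicat_real (A n j) x \<partial>distr P S (X i))"
          unfolding law[OF i] by (simp add: p_def sets_\<nu> sets.Int_space_eq2)
        also have "\<dots> = expectation (\<lambda>\<omega>. indicat_real (A n j) (X i \<omega>))"
          using i by (intro integral_distr) auto
        finally show "expectation (\<lambda>\<omega>. indicat_real (A n j) (X i \<omega>)) = p n" by simp
        show "integrable P (\<lambda>\<omega>. indicat_real (A n j) (X i \<omega>))"
          using i by (intro integrable_const_bound[where B=1]) (auto simp: indicator_def)
      qed
      have zero: "expectation (Y i) = 0" if "i \<in> {1..n}" for i
        using Xp[OF that] Xi[OF that] by (simp add: Y_def[abs_def] prob_space)
      have sq: "expectation (\<lambda>\<omega>. (Y i \<omega>)\<^sup>2) \<le> p n" if "i \<in> {1..n}" for i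
      proof -
        \<comment> \<open>An indicator equals its square, so the squared deviation is affine in it
          and its mean is \<open>p n - (p n)\<^sup>2\<close>.\<close>
        have "(Y i \<omega>)\<^sup>2 = (1 - 2 * p n) * indicator (A n j) (X i \<omega>) + (p n)\<^sup>2" for \<omega>
          by (auto simp: Y_def indicator_def power2_eq_square algebra_simps)
        then have "expectation (\<lambda>\<omega>. (Y i \<omega>)\<^sup>2) = (1 - 2 * p n) * p n + (p n)\<^sup>2"
          using Xi[OF that] Xp[OF that] by (simp add: prob_space)
        also have "\<dots> \<le> p n" using p01 by (simp add: power2_eq_square algebra_simps)
        finally show ?thesis .
      qed
      have indY: "indep_vars (\<lambda>_. borel) Y {1..n}"
        unfolding Y_def by (rule indep_vars_compose2[OF indep_vars_subset[OF indep]]) auto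
      note E2 = expectation_square_sum_indep[OF finite_atLeastAtMost indY int zero]
      have intsum: "integrable P (\<lambda>\<omega>. \<Sum>i=1..n. Y i \<omega>)" using int by auto
      have "expectation (\<lambda>\<omega>. \<bar>\<Sum>i=1..n. Y i \<omega>\<bar>) \<le> sqrt (expectation (\<lambda>\<omega>. (\<Sum>i=1..n. Y i \<omega>)\<^sup>2))"
        by (rule expectation_abs_le_sqrt[OF intsum E2(1)])
      also have "\<dots> \<le> sqrt (real n * p n)"
        using sum_mono[of "{1..n}", OF sq] by (intro real_sqrt_le_mono) (simp add: E2(2)[simplified])
      finally have L1: "expectation (\<lambda>\<omega>. \<bar>\<Sum>i=1..n. Y i \<omega>\<bar>) \<le> sqrt (real n * p n)" .
      have "hits n j \<omega> = (\<Sum>i=1..n. Y i \<omega>) + real n * p n" for \<omega>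
        by (simp add: hits_def Y_def sum_subtractf)
      then have dec: "real j * hits n j \<omega> / (real n * d n) - 1
          = real j / (real n * d n) * (\<Sum>i=1..n. Y i \<omega>) + (real j * p n / d n - 1)" for \<omega>
        using n by (simp add: field_simps)
      have "\<bar>real j * hits n j \<omega> / (real n * d n) - 1\<bar>
          \<le> real j / (real n * d n) * \<bar>\<Sum>i=1..n. Y i \<omega>\<bar> + \<bar>real j * p n / d n - 1\<bar>" for \<omega>
        unfolding dec by (rule order_trans[OF abs_triangle_ineq]) (use n in \<open>simp add: abs_mult\<close>)
      then have "expectation (\<lambda>\<omega>. \<bar>real j * hits n j \<omega> / (real n * d n) - 1\<bar>)
          \<le> expectation (\<lambda>\<omega>. real j / (real n * d n) * \<bar>\<Sum>i=1..n. Y i \<omega>\<bar> + \<bar>real j * p n / d n - 1\<bar>)"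
        using intsum unfolding dec by (intro integral_mono) auto
      also have "\<dots> = real j / (real n * d n) * expectation (\<lambda>\<omega>. \<bar>\<Sum>i=1..n. Y i \<omega>\<bar>) + \<bar>real j * p n / d n - 1\<bar>"
        using intsum by (simp add: prob_space)
      also have "\<dots> \<le> b n"
        unfolding b_def using L1 n by (intro add_right_mono mult_left_mono) auto
      finally show ?case by (simp add: integral_nonneg_AE)
    qed
  qed
qed

lemma normalized_mean_concentration:
  "(\<lambda>n. \<integral>\<omega>. \<bar>normalized_mean n \<omega> - 1\<bar> \<partial>P) \<longlonglongrightarrow> 0"
  and normalized_mean_integrable: "integrable P (\<lambda>\<omega>. \<bar>normalized_mean n \<omega> - 1\<bar>)"
proof -
  define Y where "Y n j \<omega> = \<bar>real j * hits n j \<omega> / (real n * d n) - 1\<bar>" for n j \<omega>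
  have hb: "\<bar>hits n j \<omega>\<bar> \<le> real n" for n j \<omega>
  proof -
    have "\<bar>hits n j \<omega>\<bar> \<le> (\<Sum>i=1..n. \<bar>indicat_real (A n j) (X i \<omega>)\<bar>)"
      unfolding hits_def by (rule sum_abs)
    also have "\<dots> \<le> (\<Sum>i=1..n. 1)" by (intro sum_mono) (auto simp: indicator_def)
    finally show ?thesis by simp
  qed
  have hi: "integrable P (hits n j)" for n j
    by (rule integrable_const_bound[where B="real n"]) (use hb in auto)
  have Yi: "integrable P (Y n j)" for n j
    unfolding Y_def using hi by auto
  show mi: "integrable P (\<lambda>\<omega>. \<bar>normalized_mean n \<omega> - 1\<bar>)" for n
    unfolding normalized_mean_def using hi by (intro integrable_abs) auto
  have le: "\<bar>normalized_mean n \<omega> - 1\<bar> \<le> 1 / real k * (\<Sum>j=1..k. Y n j \<omega>)" for n \<omega>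
  proof -
    have "normalized_mean n \<omega> - 1 = 1 / real k * (\<Sum>j=1..k. real j * hits n j \<omega> / (real n * d n) - 1)"
      using k_pos by (simp add: normalized_mean_def sum_subtractf sum_divide_distrib right_diff_distrib mult_ac)
    also have "\<bar>\<dots>\<bar> \<le> 1 / real k * (\<Sum>j=1..k. Y n j \<omega>)"
      unfolding abs_mult Y_def by (intro mult_mono sum_abs) auto
    finally show ?thesis .
  qed
  have "(\<lambda>n. 1 / real k * (\<Sum>j=1..k. \<integral>\<omega>. Y n j \<omega> \<partial>P)) \<longlonglongrightarrow> 1 / real k * (\<Sum>j=1..k. 0)"
    unfolding Y_def by (intro tendsto_intros hits_concentration)
  then have lim: "(\<lambda>n. 1 / real k * (\<Sum>j=1..k. \<integral>\<omega>. Y n j \<omega> \<partial>P)) \<longlonglongrightarrow> 0" by simp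
  show "(\<lambda>n. \<integral>\<omega>. \<bar>normalized_mean n \<omega> - 1\<bar> \<partial>P) \<longlonglongrightarrow> 0"
  proof (rule Lim_null_comparison[OF always_eventually lim], rule allI)
    fix n
    have "(\<integral>\<omega>. \<bar>normalized_mean n \<omega> - 1\<bar> \<partial>P) \<le> (\<integral>\<omega>. 1 / real k * (\<Sum>j=1..k. Y n j \<omega>) \<partial>P)"
      using le mi Yi by (intro integral_mono) auto
    also have "\<dots> = 1 / real k * (\<Sum>j=1..k. \<integral>\<omega>. Y n j \<omega> \<partial>P)"
      using Yi by simp
    finally show "norm (\<integral>\<omega>. \<bar>normalized_mean n \<omega> - 1\<bar> \<partial>P) \<le> 1 / real k * (\<Sum>j=1..k. \<integral>\<omega>. Y n j \<omega> \<partial>P)"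
      by (simp add: integral_nonneg_AE)
  qed
qed

section \<open>Limit law of the statistic for nested arrays\<close>

definition statistic :: "nat \<Rightarrow> 'd \<Rightarrow> real" where
  "statistic n \<omega> =
     (\<Sum>j=1..k. (real j * hits n j \<omega> - 1 / real k * (\<Sum>l=1..k. real l * hits n l \<omega>))\<^sup>2)
     / (1 / real k * (\<Sum>l=1..k. real l * hits n l \<omega>))"

lemma statistic_measurable [measurable]: "statistic n \<in> borel_measurable P"
  unfolding statistic_def by measurable

lemma hits_nonneg: "0 \<le> hits n j \<omega>"
  unfolding hits_def by (intro sum_nonneg) auto

lemma statistic_nonneg: "0 \<le> statistic n \<omega>"
  unfolding statistic_def using hits_nonneg by (intro divide_nonneg_nonneg sum_nonneg mult_nonneg_nonneg) auto

text \<open>Parseval's identity for the numerator; the scale \<open>n * d n\<close> cancels. If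
  there are no hits, both quotients are \<open>0 / 0\<close> and equal 0.\<close>

lemma statistic_eq_score:
  assumes "n \<ge> 1"
  shows "statistic n \<omega> = (\<Sum>i=1..k-1. (score n i \<omega>)\<^sup>2) / normalized_mean n \<omega>"
proof -
  have nd: "real n > 0" "d n > 0" using assms d_pos by auto
  have "(\<Sum>i=1..k-1. (score n i \<omega>)\<^sup>2) = (\<Sum>i=1..k-1. (\<Sum>j=1..k. dct k i j * (real j * hits n j \<omega>))\<^sup>2) / (real n * d n)"
    using nd by (simp add: score_def power_divide sum_divide_distrib[symmetric])
  then have "(\<Sum>j=1..k. (real j * hits n j \<omega> - 1 / real k * (\<Sum>l=1..k. real l * hits n l \<omega>))\<^sup>2)
     = (\<Sum>i=1..k-1. (score n i \<omega>)\<^sup>2) * (real n * d n)"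
    unfolding sum_squares_centered_dct using nd by simp
  then show ?thesis
    using nd by (simp add: statistic_def normalized_mean_def)
qed

text \<open>The Laplace transform of the squared norm of the scores converges by the central limit
  theorem above. Dividing by \<open>normalized_mean\<close> changes it by at most twice the mean
  distance of that variable from 1, which vanishes.\<close>

lemma statistic_weak_conv:
  fixes R :: "'e measure"
  assumes R: "prob_space R" and ind: "prob_space.indep_vars R (\<lambda>_. borel) \<xi> {1..k-1}"
    and dist: "\<And>i. i \<in> {1..k-1} \<Longrightarrow> distributed R lborel (\<xi> i) std_normal_density"
  shows "weak_conv_m (\<lambda>n. distr P borel (statistic n))
    (distr R borel (\<lambda>x. \<Sum>i=1..k-1. dct_eigenvalue k i * (\<xi> i x)\<^sup>2))"
proof -
  interpret R: prob_space R by fact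
  have rv[measurable]: "\<xi> i \<in> borel_measurable R" if "i \<in> {1..k-1}" for i
    using ind that unfolding R.indep_vars_def2 by auto
  have limit_meas[measurable]: "(\<lambda>x. \<Sum>i=1..k-1. dct_eigenvalue k i * (\<xi> i x)\<^sup>2) \<in> borel_measurable R"
    by measurable
  show ?thesis
  proof (rule weak_conv_m_of_laplace)
    show "real_distribution (distr P borel (statistic n))" for n
      by (rule real_distribution_distr) measurable
    show "real_distribution (distr R borel (\<lambda>x. \<Sum>i=1..k-1. dct_eigenvalue k i * (\<xi> i x)\<^sup>2))"
      by (rule R.real_distribution_distr) measurable
    show "AE x in distr P borel (statistic n). 0 \<le> x" for n
      by (subst AE_distr_iff) (auto simp: statistic_nonneg)
    show "AE x in distr R borel (\<lambda>x. \<Sum>i=1..k-1. dct_eigenvalue k i * (\<xi> i x)\<^sup>2). 0 \<le> x"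
      by (subst AE_distr_iff) (auto simp: dct_eigenvalue_def intro!: sum_nonneg)
    fix s :: nat
    let ?Q = "\<lambda>n \<omega>. \<Sum>i=1..k-1. (score n i \<omega>)\<^sup>2"
    have lap: "(\<lambda>n. \<integral>\<omega>. exp (- (real s * ?Q n \<omega>)) \<partial>P)
        \<longlonglongrightarrow> (\<integral>x. exp (- (real s * (\<Sum>i=1..k-1. dct_eigenvalue k i * (\<xi> i x)\<^sup>2))) \<partial>R)"
      by (rule tendsto_laplace_sum_squares[OF prob_space_axioms R _ ind dist])
        (simp, assumption, rule score_measurable, rule characteristic_function_score, simp)
    have "(\<lambda>n. (\<integral>\<omega>. exp (- (real s * statistic n \<omega>)) \<partial>P) - (\<integral>\<omega>. exp (- (real s * ?Q n \<omega>)) \<partial>P)) \<longlonglongrightarrow> 0"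
    proof (rule Lim_null_comparison)
      show "(\<lambda>n. 2 * (\<integral>\<omega>. \<bar>normalized_mean n \<omega> - 1\<bar> \<partial>P)) \<longlonglongrightarrow> 0"
        using tendsto_mult_right_zero[OF normalized_mean_concentration] by simp
      show "eventually (\<lambda>n. norm ((\<integral>\<omega>. exp (- (real s * statistic n \<omega>)) \<partial>P) - (\<integral>\<omega>. exp (- (real s * ?Q n \<omega>)) \<partial>P))
          \<le> 2 * (\<integral>\<omega>. \<bar>normalized_mean n \<omega> - 1\<bar> \<partial>P)) sequentially"
        using eventually_ge_at_top[of 1]
      proof eventually_elim
        case (elim n)
        have i1: "integrable P (\<lambda>\<omega>. exp (- (real s * statistic n \<omega>)))"
          by (rule integrable_const_bound[where B=1]) (auto simp: statistic_nonneg)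
        have i2: "integrable P (\<lambda>\<omega>. exp (- (real s * ?Q n \<omega>)))"
          by (rule integrable_const_bound[where B=1]) (auto intro!: mult_nonneg_nonneg sum_nonneg)
        have nm: "0 \<le> normalized_mean n \<omega>" for \<omega>
          unfolding normalized_mean_def using hits_nonneg d_pos[OF elim]
          by (intro divide_nonneg_nonneg sum_nonneg mult_nonneg_nonneg) auto
        have "norm ((\<integral>\<omega>. exp (- (real s * statistic n \<omega>)) \<partial>P) - (\<integral>\<omega>. exp (- (real s * ?Q n \<omega>)) \<partial>P))
           = norm (\<integral>\<omega>. exp (- (real s * statistic n \<omega>)) - exp (- (real s * ?Q n \<omega>)) \<partial>P)"
          using i1 i2 by simp
        also have "\<dots> \<le> (\<integral>\<omega>. norm (exp (- (real s * statistic n \<omega>)) - exp (- (real s * ?Q n \<omega>))) \<partial>P)"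
          by (rule integral_norm_bound)
        also have "\<dots> \<le> (\<integral>\<omega>. 2 * \<bar>normalized_mean n \<omega> - 1\<bar> \<partial>P)"
        proof (rule integral_mono)
          fix \<omega>
          show "norm (exp (- (real s * statistic n \<omega>)) - exp (- (real s * ?Q n \<omega>))) \<le> 2 * \<bar>normalized_mean n \<omega> - 1\<bar>"
            unfolding statistic_eq_score[OF elim] real_norm_def
            using nm by (intro abs_exp_divide_diff_le sum_nonneg) auto
        qed (use i1 i2 normalized_mean_integrable in auto)
        finally show ?case by simp
      qed
    qed
    from tendsto_add[OF this lap]
    have "(\<lambda>n. \<integral>\<omega>. exp (- (real s * statistic n \<omega>)) \<partial>P)
        \<longlonglongrightarrow> (\<integral>x. exp (- (real s * (\<Sum>i=1..k-1. dct_eigenvalue k i * (\<xi> i x)\<^sup>2))) \<partial>R)" by simp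
    then show "(\<lambda>n. \<integral>x. exp (- (real s * x)) \<partial>distr P borel (statistic n))
        \<longlonglongrightarrow> (\<integral>x. exp (- (real s * x)) \<partial>distr R borel (\<lambda>x. \<Sum>i=1..k-1. dct_eigenvalue k i * (\<xi> i x)\<^sup>2))"
      by (simp add: integral_distr)
  qed
qed

end

section \<open>Exceedances of copula processes\<close>

text \<open>A nondegenerate interval supplies both positive Lebesgue measure for the sojourn time
  and a rational time of exceedance.\<close>

lemma exceedance_contains_interval:
  fixes u :: "real \<Rightarrow> real"
  assumes u: "continuous_on {0..1} u" and t: "t \<in> {0..1}" "b < u t"
  obtains x y where "x < y" "{x<..<y} \<subseteq> {t\<in>{0..1}. b < u t}"
proof -
  obtain T where T: "open T" "T \<inter> {0..1} = u -` {b<..} \<inter> {0..1}"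
    using u continuous_on_open_invariant[of "{0..1}" u] open_greaterThan[of b] by blast
  with t have "t \<in> T" by auto
  then obtain e where e: "e > 0" "ball t e \<subseteq> T" using T(1) open_contains_ball by blast
  show thesis
  proof
    \<comment> \<open>The ball is clipped to (0,1), because \<open>t\<close> may be an endpoint of
      the time interval.\<close>
    show "max 0 (t - e) < min 1 (t + e)" using e t by auto
    show "{max 0 (t - e)<..<min 1 (t + e)} \<subseteq> {t\<in>{0..1}. b < u t}"
    proof
      fix s assume "s \<in> {max 0 (t - e)<..<min 1 (t + e)}"
      then have "s \<in> T \<inter> {0..1}" using e(2) by (auto simp: dist_real_def subset_iff)
      then show "s \<in> {t\<in>{0..1}. b < u t}" unfolding T(2) by auto
    qed
  qed
qed

text \<open>The sojourn time is the Lebesgue measure of the exceedance set: at most 1, zero if that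
  set is empty, and positive otherwise by the interval lemma.\<close>

lemma sojourn_positive_iff:
  assumes u: "continuous_on {0..1} u"
  shows "sojourn u s \<in> {0<..1} \<longleftrightarrow> (\<exists>t\<in>{0..1}. 1 + s < u t)"
proof -
  define E where "E = {t\<in>{0..1}. 1 + s < u t}"
  \<comment> \<open>Values of \<open>u\<close> off [0,1] are arbitrary. The product with the
    indicator is 0 there, hence never in \<open>{0<..}\<close>, and is measurable on the whole
    line.\<close>
  have "(\<lambda>t. indicat_real {0..1} t *\<^sub>R (u t - (1 + s))) \<in> borel_measurable borel"
    using u by (intro borel_measurable_continuous_on_indicator continuous_intros) auto
  then have "(\<lambda>t. indicat_real {0..1} t *\<^sub>R (u t - (1 + s))) -` {0<..} \<in> sets borel"
    by (rule measurable_sets_borel) simp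
  also have "(\<lambda>t. indicat_real {0..1} t *\<^sub>R (u t - (1 + s))) -` {0<..} = E"
    by (auto simp: E_def indicator_def of_bool_def split: if_splits)
  finally have E: "E \<in> sets borel" .
  have "sojourn u s = (\<integral>t. indicat_real E t \<partial>lborel)"
    unfolding sojourn_def set_lebesgue_integral_def
    by (intro Bochner_Integration.integral_cong) (auto simp: E_def indicator_def)
  then have so: "sojourn u s = measure lborel E" using E by simp
  have I: "{0..1::real} \<in> fmeasurable lborel" by (rule fmeasurableI) auto
  have "E \<subseteq> {0..1}" by (auto simp: E_def)
  then have "measure lborel E \<le> measure lborel {0..1::real}"
    using E I by (intro measure_mono_fmeasurable) auto
  then have le1: "sojourn u s \<le> 1" unfolding so by simp
  show ?thesis
  proof
    assume "sojourn u s \<in> {0<..1}"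
    then have "E \<noteq> {}" unfolding so by auto
    then show "\<exists>t\<in>{0..1}. 1 + s < u t" by (auto simp: E_def)
  next
    assume "\<exists>t\<in>{0..1}. 1 + s < u t"
    then obtain x y where xy: "x < y" "{x<..<y} \<subseteq> E"
      using exceedance_contains_interval[OF u] unfolding E_def by metis
    have "E \<in> fmeasurable lborel"
      using E I \<open>E \<subseteq> {0..1}\<close> by (intro fmeasurableI2[of "{0..1}" lborel E]) auto
    then have "measure lborel {x<..<y} \<le> measure lborel E"
      using xy by (intro measure_mono_fmeasurable) auto
    then show "sojourn u s \<in> {0<..1}" using le1 xy unfolding so by simp
  qed
qed

text \<open>Restricting to rational times keeps the set measurable in the product algebra; for continuous paths
  nothing is lost.\<close>

definition path_exceeds :: "real \<Rightarrow> (real \<Rightarrow> real) set" where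
  "path_exceeds b = {x \<in> space path_algebra. \<exists>q\<in>\<rat> \<inter> {0..1}. b < x q}"

lemma path_exceeds_sets [measurable]: "path_exceeds b \<in> sets path_algebra"
  unfolding path_exceeds_def
  by (intro sets.sets_Collect_countable_Ex' countable_Int1 countable_rat) measurable

lemma sample_path_mem_path_exceeds:
  assumes "continuous_on {0..1} (\<lambda>t. U t \<omega>)"
  shows "sample_path U \<omega> \<in> path_exceeds b \<longleftrightarrow> (\<exists>t\<in>{0..1}. b < U t \<omega>)"
proof
  assume "sample_path U \<omega> \<in> path_exceeds b"
  then show "\<exists>t\<in>{0..1}. b < U t \<omega>" by (auto simp: path_exceeds_def sample_path_def)
next
  assume "\<exists>t\<in>{0..1}. b < U t \<omega>"
  then obtain x y where xy: "x < y" "{x<..<y} \<subseteq> {t\<in>{0..1}. b < U t \<omega>}"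
    using exceedance_contains_interval[OF assms] by metis
  obtain q where "q \<in> \<rat>" "x < q" "q < y" using Rats_dense_in_real[OF xy(1)] by blast
  with xy(2) have q: "q \<in> \<rat> \<inter> {0..1}" "b < U q \<omega>" by auto
  then show "sample_path U \<omega> \<in> path_exceeds b"
    by (auto simp: path_exceeds_def sample_path_def space_PiM intro!: bexI[of _ q])
qed

lemma sample_path_measurable:
  assumes "stochastic_process M U"
  shows "sample_path U \<in> M \<rightarrow>\<^sub>M path_algebra"
  using assms unfolding sample_path_def stochastic_process_def
  by (intro measurable_restrict) auto

lemma measure_path_exceeds:
  assumes "stochastic_process M U" "paths_in_C M U"
  shows "measure (distr M path_algebra (sample_path U)) (path_exceeds b) = 1 - prob_le M U (\<lambda>t. b)"
proof -
  interpret prob_space M using assms by (simp add: stochastic_process_def)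
  note [measurable] = sample_path_measurable[OF assms(1)]
  have "sample_path U \<omega> \<in> path_exceeds b \<longleftrightarrow> (\<exists>t\<in>{0..1}. b < U t \<omega>)" if "\<omega> \<in> space M" for \<omega>
    using assms(2) that by (intro sample_path_mem_path_exceeds) (auto simp: paths_in_C_def)
  then have "{\<omega>\<in>space M. \<forall>t\<in>{0..1}. U t \<omega> \<le> b} = space M - (sample_path U -` path_exceeds b \<inter> space M)"
    by (auto simp: not_less[symmetric])
  then have "prob_le M U (\<lambda>t. b) = 1 - prob (sample_path U -` path_exceeds b \<inter> space M)"
    unfolding prob_le_def by (subst prob_compl[symmetric]) auto
  then show ?thesis by (simp add: measure_distr)
qed

section \<open>The D-norm of constants and the exceedance probability\<close>

lemma const_E01_neg: "a \<le> 0 \<Longrightarrow> (\<lambda>t. a) \<in> E01_neg"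
  by (simp add: E01_neg_def E01_def image_constant_conv)

lemma sup_norm_const: "sup_norm (\<lambda>t. a) = \<bar>a\<bar>"
  by (simp add: sup_norm_def)

lemma D_norm_const:
  assumes Z: "generator_process Q Z" and "a \<noteq> 0"
  shows "D_norm Q Z (\<lambda>t. a) = \<bar>a\<bar> * D_norm Q Z (\<lambda>t. 1)"
proof -
  obtain q where q: "\<And>\<omega> t. \<omega> \<in> space Q \<Longrightarrow> t \<in> {0..1} \<Longrightarrow> Z t \<omega> \<le> q"
    using Z unfolding generator_process_def by blast
  have "(SUP t\<in>{0..1}. \<bar>a\<bar> * Z t \<omega>) = \<bar>a\<bar> * (SUP t\<in>{0..1}. Z t \<omega>)" if "\<omega> \<in> space Q" for \<omega>
  proof -
    \<comment> \<open>The uniform bound on the generator makes the supremum a genuine one, so the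
      monotone continuous scaling passes through it.\<close>
    have "bdd_above ((\<lambda>t. Z t \<omega>) ` {0..1})" using q[OF that] by (intro bdd_aboveI[where M=q]) auto
    then have "\<bar>a\<bar> * Sup ((\<lambda>t. Z t \<omega>) ` {0..1}) = (SUP x\<in>(\<lambda>t. Z t \<omega>) ` {0..1}. \<bar>a\<bar> * x)"
      by (intro continuous_at_Sup_mono[of "\<lambda>x. \<bar>a\<bar> * x"]) (auto intro!: monoI mult_left_mono continuous_intros)
    then show ?thesis by (simp add: image_image)
  qed
  then show ?thesis
    unfolding D_norm_def by (simp cong: Bochner_Integration.integral_cong)
qed

lemma GPCP_prob_le_const:
  assumes "GPCP N V Q Z"
  shows "eventually (\<lambda>c. prob_le N V (\<lambda>t. 1 - c) = 1 - c * D_norm Q Z (\<lambda>t. 1)) (at_right 0)"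
proof -
  from assms obtain \<epsilon> where \<epsilon>: "\<epsilon> > 0" and
    V: "\<And>f. f \<in> E01_neg \<Longrightarrow> sup_norm f \<le> \<epsilon> \<Longrightarrow> prob_le N V (\<lambda>t. 1 + f t) = 1 - D_norm Q Z f"
    and Z: "generator_process Q Z" unfolding GPCP_def by blast
  have "eventually (\<lambda>c. 0 < c \<and> c < \<epsilon>) (at_right (0::real))"
    using eventually_at_right_real[OF \<epsilon>] by simp
  then show ?thesis
  proof eventually_elim
    case (elim c)
    then show ?case
      using V[OF const_E01_neg[of "- c"]] D_norm_const[OF Z, of "- c"] by (simp add: sup_norm_const)
  qed
qed

text \<open>The marginal bound \<open>P(V \<le> 1 - c) \<le> P(V\<^sub>0 \<le> 1 - c) = 1 - c\<close> gives a lower bound on the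
  \<open>D\<close>-norm that does not need the supremum of the generator to be integrable.\<close>

lemma D_norm_one_ge_1:
  assumes "GPCP N V Q Z"
  shows "D_norm Q Z (\<lambda>t. 1) \<ge> 1"
proof -
  have "copula_process N V" using assms by (simp add: GPCP_def)
  then have sp: "stochastic_process N V" and
    d: "distr N borel (V 0) = uniform_measure lborel {0<..<1}" by (auto simp: copula_process_def)
  interpret prob_space N using sp by (simp add: stochastic_process_def)
  have V0[measurable]: "V 0 \<in> borel_measurable N" using sp by (auto simp: stochastic_process_def)
  have "eventually (\<lambda>c. prob_le N V (\<lambda>t. 1 - c) = 1 - c * D_norm Q Z (\<lambda>t. 1) \<and> c \<in> {0<..<1}) (at_right 0)"
    using GPCP_prob_le_const[OF assms] eventually_at_right_real[of 0 1] by (intro eventually_conj) auto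
  then obtain c where c: "prob_le N V (\<lambda>t. 1 - c) = 1 - c * D_norm Q Z (\<lambda>t. 1)" "0 < c" "c < 1"
    using eventually_happens by fastforce
  have "prob_le N V (\<lambda>t. 1 - c) \<le> prob (V 0 -` {..1 - c} \<inter> space N)"
    unfolding prob_le_def by (intro finite_measure_mono) auto
  also have "\<dots> = measure (uniform_measure lborel {0<..<1}) {..1 - c}"
    unfolding d[symmetric] by (subst measure_distr) auto
  also have "\<dots> = measure lborel ({0<..<1} \<inter> {..1 - c}) / measure lborel {0<..<1::real}"
    by (intro measure_uniform_measure) auto
  also have "{0<..<1} \<inter> {..1 - c} = {0<..1 - c}" using c by auto
  finally have "1 - c * D_norm Q Z (\<lambda>t. 1) \<le> 1 - c" using c by simp
  then show ?thesis using c by simp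
qed

text \<open>The direction \<open>f = -1\<close> turns the neighborhood condition into a statement on
  the levels \<open>1 - c\<close>, where the probability for \<open>V\<close> is exactly linear in
  small \<open>c\<close>.\<close>

lemma exceedance_expansion:
  assumes "in_delta_neighborhood \<delta> M U N V Q Z"
  shows "\<exists>C>0. eventually (\<lambda>c. \<bar>1 - prob_le M U (\<lambda>t. 1 - c) - c * D_norm Q Z (\<lambda>t. 1)\<bar> \<le> C * c powr (1 + \<delta>)) (at_right 0)"
proof -
  have nb: "(\<lambda>c. prob_le M U (\<lambda>t. 1 + c * f t) - prob_le N V (\<lambda>t. 1 + c * f t))
      \<in> O[at_right 0](\<lambda>c. c powr (1 + \<delta>))" if "f \<in> E01_neg" for f
    using assms that by (simp add: in_delta_neighborhood_def)
  have V: "GPCP N V Q Z" using assms by (simp add: in_delta_neighborhood_def)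
  from nb[OF const_E01_neg[of "-1"]]
  have "(\<lambda>c. prob_le M U (\<lambda>t. 1 - c) - prob_le N V (\<lambda>t. 1 - c)) \<in> O[at_right 0](\<lambda>c. c powr (1 + \<delta>))"
    by simp
  then obtain C where C: "C > 0" and
    ev: "eventually (\<lambda>c. norm (prob_le M U (\<lambda>t. 1 - c) - prob_le N V (\<lambda>t. 1 - c)) \<le> C * norm (c powr (1 + \<delta>))) (at_right 0)"
    by (elim landau_o.bigE)
  from ev GPCP_prob_le_const[OF V]
  have "eventually (\<lambda>c. \<bar>1 - prob_le M U (\<lambda>t. 1 - c) - c * D_norm Q Z (\<lambda>t. 1)\<bar> \<le> C * c powr (1 + \<delta>)) (at_right 0)"
    by eventually_elim auto
  with C show ?thesis by blast
qed

lemma remainder_bigo: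
  assumes U: "in_delta_neighborhood \<delta> M U N V Q Z"
    and r: "\<And>c. c > 0 \<Longrightarrow> prob_le M U (\<lambda>t. 1 - c) = 1 - c * (D_norm Q Z (\<lambda>t. 1) + r (- c))"
  shows "r \<in> O[at_left 0](\<lambda>s. \<bar>s\<bar> powr \<delta>)"
proof -
  obtain C where
    ev: "eventually (\<lambda>c. \<bar>1 - prob_le M U (\<lambda>t. 1 - c) - c * D_norm Q Z (\<lambda>t. 1)\<bar> \<le> C * c powr (1 + \<delta>)) (at_right 0)"
    using exceedance_expansion[OF U] by blast
  have "eventually (\<lambda>c. norm (r (- c)) \<le> C * norm (\<bar>- c\<bar> powr \<delta>)) (at_right 0)"
    using ev eventually_at_right_less[of 0]
  proof eventually_elim
    case (elim c)
    have "c * \<bar>r (- c)\<bar> \<le> c * (C * c powr \<delta>)"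
      using elim r[of c] by (simp add: powr_add algebra_simps abs_mult)
    then show ?case using elim(2) by simp
  qed
  then have "eventually (\<lambda>s. norm (r s) \<le> C * norm (\<bar>s\<bar> powr \<delta>)) (at_left 0)"
    unfolding at_left_minus[of 0] eventually_filtermap by simp
  then show ?thesis by (rule bigoI)
qed

text \<open>The place where the rate condition enters: an error of order
  \<open>c powr (1 + \<delta>)\<close>, multiplied by \<open>sqrt (n / c)\<close>, is of order
  \<open>sqrt (n * c powr (1 + 2 * \<delta>))\<close>.\<close>

lemma exceedance_bias_tendsto_0:
  assumes m: "m > 0"
    and p: "eventually (\<lambda>x. \<bar>p x - x * m\<bar> \<le> C * x powr (1 + \<delta>)) (at_right 0)"
    and c: "\<And>n. n \<ge> 1 \<Longrightarrow> c n > 0" "c \<longlonglongrightarrow> 0"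
    and nc: "(\<lambda>n. real n * c n powr (1 + 2 * \<delta>)) \<longlonglongrightarrow> 0"
    and j: "j \<ge> 1"
  shows "(\<lambda>n. sqrt (real n / (c n * m)) * (real j * p (c n / real j) - c n * m)) \<longlonglongrightarrow> 0"
proof (rule Lim_null_comparison)
  define K where "K = real j * \<bar>C\<bar> * (1 / real j) powr (1 + \<delta>)"
  have "(\<lambda>n. K * sqrt (real n * c n powr (1 + 2 * \<delta>) / m)) \<longlonglongrightarrow> K * sqrt (0 / m)"
    using m by (intro tendsto_intros nc) auto
  then show "(\<lambda>n. K * sqrt (real n * c n powr (1 + 2 * \<delta>) / m)) \<longlonglongrightarrow> 0" by simp
  \<comment> \<open>The expansion of \<open>p\<close> is a right-sided one, so its arguments must
    approach 0 through positive values.\<close>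
  have "filterlim (\<lambda>n. c n / real j) (at_right 0) sequentially"
    unfolding filterlim_at
  proof
    show "eventually (\<lambda>n. c n / real j \<in> {0<..} \<and> c n / real j \<noteq> 0) sequentially"
      using eventually_ge_at_top[of 1]
    proof eventually_elim
      case (elim n)
      then have "c n > 0" "real j > 0" using c(1) j by auto
      then show ?case by simp
    qed
    show "(\<lambda>n. c n / real j) \<longlonglongrightarrow> 0"
      using tendsto_divide_zero[OF c(2)] by simp
  qed
  from eventually_compose_filterlim[OF p this] eventually_ge_at_top[of 1]
  show "eventually (\<lambda>n. norm (sqrt (real n / (c n * m)) * (real j * p (c n / real j) - c n * m))
     \<le> K * sqrt (real n * c n powr (1 + 2 * \<delta>) / m)) sequentially"
  proof eventually_elim
    case (elim n)
    then have cn: "c n > 0" and n: "real n > 0" using c by auto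
    have "\<bar>real j * p (c n / real j) - c n * m\<bar> = real j * \<bar>p (c n / real j) - c n / real j * m\<bar>"
      using j by (simp add: abs_mult[symmetric] field_simps)
    also have "\<dots> \<le> real j * (\<bar>C\<bar> * (c n / real j) powr (1 + \<delta>))"
      using elim(1) by (intro mult_left_mono order_trans[OF elim(1)] mult_right_mono) auto
    also have "(c n / real j) powr (1 + \<delta>) = (1 / real j) powr (1 + \<delta>) * c n powr (1 + \<delta>)"
      using cn by (simp add: powr_mult[symmetric])
    finally have 1: "\<bar>real j * p (c n / real j) - c n * m\<bar> \<le> K * c n powr (1 + \<delta>)"
      by (simp add: K_def mult_ac)
    \<comment> \<open>Under the root, one factor \<open>c n\<close> is split off to cancel the one
      in \<open>n / (c n * m)\<close>.\<close>
    have "c n powr (1 + \<delta>) = sqrt (c n powr (1 + \<delta>) * c n powr (1 + \<delta>))"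
      by simp
    also have "c n powr (1 + \<delta>) * c n powr (1 + \<delta>) = c n * c n powr (1 + 2 * \<delta>)"
      using cn by (simp add: powr_add[symmetric] powr_mult_base)
    finally have 2: "sqrt (real n / (c n * m)) * c n powr (1 + \<delta>)
        = sqrt (real n / (c n * m) * (c n * c n powr (1 + 2 * \<delta>)))"
      by (simp only: real_sqrt_mult)
    have "norm (sqrt (real n / (c n * m)) * (real j * p (c n / real j) - c n * m))
        = sqrt (real n / (c n * m)) * \<bar>real j * p (c n / real j) - c n * m\<bar>"
      using n cn m by (simp add: abs_mult)
    also have "\<dots> \<le> sqrt (real n / (c n * m)) * (K * c n powr (1 + \<delta>))"
      using n cn m by (intro mult_left_mono 1) auto
    also have "\<dots> = K * (sqrt (real n / (c n * m)) * c n powr (1 + \<delta>))" by simp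
    also have "sqrt (real n / (c n * m)) * c n powr (1 + \<delta>) = sqrt (real n * c n powr (1 + 2 * \<delta>) / m)"
      unfolding 2 using cn by simp
    finally show ?case .
  qed
qed

section \<open>Application to the test statistic\<close>

text \<open>The abstract array is instantiated on path space: \<open>A n j\<close> is the set of
  paths exceeding \<open>1 - c n / j\<close>, and \<open>d n = c n * m\<close> with \<open>m\<close>
  the D-norm of the constant 1.\<close>

lemma test_statistic_weak_conv:
  fixes P :: "'d measure" and R :: "'e measure"
  assumes nbhd: "in_delta_neighborhood \<delta> M U N V Q Z"
    and copies: "independent_copies M U P X"
    and k: "k \<ge> 2" and c: "\<And>n. n \<ge> 1 \<Longrightarrow> c n > 0" "c \<longlonglongrightarrow> 0"
    and nc: "filterlim (\<lambda>n. real n * c n) at_top sequentially"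
    and nc\<delta>: "(\<lambda>n. real n * c n powr (1 + 2 * \<delta>)) \<longlonglongrightarrow> 0"
    and R: "prob_space R" "prob_space.indep_vars R (\<lambda>_. borel) \<xi> {1..k-1}"
      "\<And>i. i \<in> {1..k-1} \<Longrightarrow> distributed R lborel (\<xi> i) std_normal_density"
  shows "weak_conv_m
      (\<lambda>n. distr P borel (\<lambda>\<omega>. test_statistic k (\<lambda>i t. X i t \<omega>) n (c n)))
      (distr R borel (\<lambda>\<omega>. \<Sum>i=1..k-1. dct_eigenvalue k i * (\<xi> i \<omega>)\<^sup>2))"
proof -
  define m where "m = D_norm Q Z (\<lambda>t. 1)"
  define \<nu> where "\<nu> = distr M path_algebra (sample_path U)"
  define A where "A n j = path_exceeds (1 - c n / real j)" for n j
  have V: "GPCP N V Q Z" and U: "stochastic_process M U" "paths_in_C M U"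
    using nbhd by (auto simp: in_delta_neighborhood_def copula_process_def)
  have m: "m \<ge> 1" unfolding m_def by (rule D_norm_one_ge_1[OF V])
  from copies have P: "prob_space P" and paths: "\<And>i. i \<ge> 1 \<Longrightarrow> paths_in_C P (X i)"
    and law: "\<And>i. i \<ge> 1 \<Longrightarrow> distr P path_algebra (sample_path (X i)) = \<nu>"
    and ind: "prob_space.indep_vars P (\<lambda>_. path_algebra) (\<lambda>i. sample_path (X i)) {1..}"
    by (auto simp: independent_copies_def \<nu>_def)
  obtain C where ev: "eventually (\<lambda>x. \<bar>1 - prob_le M U (\<lambda>t. 1 - x) - x * m\<bar> \<le> C * x powr (1 + \<delta>)) (at_right 0)"
    using exceedance_expansion[OF nbhd] unfolding m_def by blast
  interpret prob_space P by (rule P)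
  interpret nested_array P path_algebra \<nu> "\<lambda>i. sample_path (X i)" A k "\<lambda>n. c n * m"
  proof
    show "A n l \<subseteq> A n j" if "n \<ge> 1" "1 \<le> j" "j \<le> l" for n j l
    proof -
      \<comment> \<open>A larger index raises the level \<open>1 - c n / j\<close>, so fewer paths
        exceed it.\<close>
      have "c n / real l \<le> c n / real j" using that c(1)[OF that(1)] by (intro divide_left_mono) auto
      then show ?thesis by (force simp: A_def path_exceeds_def)
    qed
    show "filterlim (\<lambda>n. real n * (c n * m)) at_top sequentially"
      using filterlim_at_top_mult_tendsto_pos[OF tendsto_const[of m] _ nc] m by (simp add: mult_ac)
    show "(\<lambda>n. sqrt (real n / (c n * m)) * (real j * measure \<nu> (A n j) - c n * m)) \<longlonglongrightarrow> 0"
      if "j \<in> {1..k}" for j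
      using exceedance_bias_tendsto_0[OF _ ev c nc\<delta>, of j] that m
      by (simp add: \<nu>_def A_def measure_path_exceeds[OF U])
    show "0 < c n * m" if "n \<ge> 1" for n using c(1)[OF that] m by simp
    show "A n j \<in> sets path_algebra" for n j unfolding A_def by (rule path_exceeds_sets)
  qed (use ind law k in auto)
  \<comment> \<open>All paths over \<open>space P\<close> are continuous, so positive sojourn time
    and membership in \<open>A n j\<close> both mean that the path exceeds the level somewhere. The
    identity is pointwise, not just almost sure.\<close>
  have count: "exceedance_count (\<lambda>i t. X i t \<omega>) n (c n) j = hits n j \<omega>" if "\<omega> \<in> space P" for \<omega> n j
    unfolding exceedance_count_def hits_def
  proof (intro sum.cong refl)
    fix i assume "i \<in> {1..n}"
    then have cont: "continuous_on {0..1} (\<lambda>t. X i t \<omega>)"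
      using paths[of i] that by (auto simp: paths_in_C_def)
    show "indicat_real {0<..1} (sojourn (\<lambda>t. X i t \<omega>) (- c n / real j)) = indicator (A n j) (sample_path (X i) \<omega>)"
      using sojourn_positive_iff[OF cont, of "- c n / real j"]
        sample_path_mem_path_exceeds[of "X i" \<omega> "1 - c n / real j", OF cont]
      by (auto simp: A_def indicator_def)
  qed
  have "distr P borel (\<lambda>\<omega>. test_statistic k (\<lambda>i t. X i t \<omega>) n (c n)) = distr P borel (statistic n)" for n
    by (intro distr_cong) (simp_all add: test_statistic_def statistic_def count)
  then show ?thesis using statistic_weak_conv[OF R] by simp
qed

theorem theorem5p1:
  fixes M :: "'a measure" and U :: "real \<Rightarrow> 'a \<Rightarrow> real"
    and N :: "'b measure" and V :: "real \<Rightarrow> 'b \<Rightarrow> real"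
    and Q :: "'c measure" and Z :: "real \<Rightarrow> 'c \<Rightarrow> real"
    and \<delta> :: real
  assumes "\<delta> > 0"
    and "in_delta_neighborhood \<delta> M U N V Q Z"
  shows
    "(\<forall>r :: real \<Rightarrow> real.
        (\<forall>c>0. prob_le M U (\<lambda>t. 1 - c) = 1 - c * (D_norm Q Z (\<lambda>t. 1) + r (- c)))
        \<longrightarrow> r \<in> O[at_left 0](\<lambda>s. \<bar>s\<bar> powr \<delta>))
     \<and>
     (\<forall>(P :: 'd measure) (X :: nat \<Rightarrow> real \<Rightarrow> 'd \<Rightarrow> real) (k :: nat) (c :: nat \<Rightarrow> real)
        (R :: 'e measure) (\<xi> :: nat \<Rightarrow> 'e \<Rightarrow> real).
        independent_copies M U P X \<longrightarrow>
        k \<ge> 2 \<longrightarrow>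
        (\<forall>n\<ge>1. c n > 0) \<longrightarrow>
        c \<longlonglongrightarrow> 0 \<longrightarrow>
        filterlim (\<lambda>n. real n * c n) at_top sequentially \<longrightarrow>
        (\<lambda>n. real n * c n powr (1 + 2 * \<delta>)) \<longlonglongrightarrow> 0 \<longrightarrow>
        prob_space R \<longrightarrow>
        prob_space.indep_vars R (\<lambda>_. borel) \<xi> {1..k-1} \<longrightarrow>
        (\<forall>i\<in>{1..k-1}. distributed R lborel (\<xi> i) std_normal_density) \<longrightarrow>
        weak_conv_m
          (\<lambda>n. distr P borel (\<lambda>\<omega>. test_statistic k (\<lambda>i t. X i t \<omega>) n (c n)))
          (distr R borel
            (\<lambda>\<omega>. \<Sum>i=1..k-1. 1 / (4 * (sin (real i / real k * (pi / 2)))\<^sup>2) * (\<xi> i \<omega>)\<^sup>2)))"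
  using remainder_bigo[OF assms(2)] test_statistic_weak_conv[OF assms(2)]
  unfolding dct_eigenvalue_def by blast

end
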